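(* Let $H$ be a complex Hilbert space and let $\theta\in[0,\pi/2)$. Let $(a_n)_{n\in\mathbb{N}}$ be a sequence of closed sectorial forms in $H$ with vertex $0$ and angle $\theta$ (not necessarily densely defined), and assume that for all $n\in\mathbb{N}$ one has $\operatorname{dom}(a_n)\supseteq\operatorname{dom}(a_{n+1})$ and the form $a_{n+1}-a_n$ (with domain $\operatorname{dom}(a_{n+1})$) is sectorial with vertex $0$ and angle $\theta$. For $n\in\mathbb{N}$ let $A_n$ be the m-sectorial linear relation in $H$ associated with $a_n$. Define $$\operatorname{dom}(a):=\Bigl\{u\in\bigcap_{n\in\mathbb{N}}\operatorname{dom}(a_n)\;:\;\sup_{n\in\mathbb{N}}\operatorname{Re} a_n(u)<\infty\Bigr\}.$$ Then for all $u,v\in\operatorname{dom}(a)$ the limit $a(u,v):=\lim_{n\to\infty}a_n(u,v)$ exists, the form $a$ thus defined is a closed sectorial form in $H$ with vertex $0$ and angle $\theta$, and $A_n\to A$ as $n\to\infty$ in strong resolvent sense, where $A$ is the m-sectorial linear relation associated with $a$.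
   Context: Inner products $(\cdot\mid\cdot)$ are linear in the first argument. For $0<\theta<\pi/2$ put $\Sigma_\theta:=\{z\in\mathbb{C}\setminus\{0\}: |\operatorname{Arg} z|<\theta\}$, and $\Sigma_0:=(0,\infty)$; $\overline{\Sigma_\theta}$ denotes the closure in $\mathbb{C}$. A sectorial form $a$ in $H$ with vertex $0$ and angle $\theta\in[0,\pi/2)$ is a sesquilinear map $a\colon\operatorname{dom}(a)\times\operatorname{dom}(a)\to\mathbb{C}$ (linear in the first, antilinear in the second argument), where $\operatorname{dom}(a)$ is a linear subspace of $H$ (not required to be dense), such that $a(u):=a(u,u)\in\overline{\Sigma_\theta}$ for all $u\in\operatorname{dom}(a)$. Here $\operatorname{Re} a_n(u)$ is the real part of $a_n(u)=a_n(u,u)$. The form $a$ is closed if $\operatorname{dom}(a)$ is complete for the norm $\|u\|_a:=(\operatorname{Re} a(u)+\|u\|_H^2)^{1/2}$. A linear relation in $H$ is a linear subspace $A$ of $H\times H$; its inverse is $A^{-1}=\{(y,x):(x,y)\in A\}$ and $I+A:=\{(x,x+y):(x,y)\in A\}$. $A$ is m-sectorial with vertex $0$ and angle $\theta$ if $(y\mid x)\in\overline{\Sigma_\theta}$ for all $(x,y)\in A$ and $\operatorname{ran}(I+A)=\{x+y:(x,y)\in A\}=H$; in this case $(I+A)^{-1}$ is (the graph of) a bounded operator on $H$. The linear relation associated with a closed sectorial form $a$ is $$A:=\{(u,y)\in\operatorname{dom}(a)\times H:\ a(u,v)=(y\mid v)_H\ \text{for all } v\in\operatorname{dom}(a)\};$$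 it is m-sectorial with vertex $0$ and the same angle as $a$. For m-sectorial linear relations with vertex $0$, $A_n\to A$ in strong resolvent sense means $(I+A_n)^{-1}f\to(I+A)^{-1}f$ in $H$ for all $f\in H$. *)

theory Defs
  imports "HOL-Analysis.Analysis"
begin

section \<open>Complex Hilbert spaces\<close>

class scaleC = scaleR +
  fixes scaleC :: "complex \<Rightarrow> 'a \<Rightarrow> 'a"  (infixr \<open>*\<^sub>C\<close> 75)
  assumes scaleR_scaleC: "r *\<^sub>R x = complex_of_real r *\<^sub>C x"

class complex_vector = scaleC + real_vector +
  assumes scaleC_add_right: "c *\<^sub>C (x + y) = c *\<^sub>C x + c *\<^sub>C y"
    and scaleC_add_left: "(c + d) *\<^sub>C x = c *\<^sub>C x + d *\<^sub>C x"
    and scaleC_scaleC: "c *\<^sub>C d *\<^sub>C x = (c * d) *\<^sub>C x"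
    and scaleC_one: "1 *\<^sub>C x = x"

text \<open>The inner product is linear in the first argument.\<close>

class complex_inner = complex_vector + real_normed_vector +
  fixes cinner :: "'a \<Rightarrow> 'a \<Rightarrow> complex"
  assumes cinner_commute: "cinner x y = cnj (cinner y x)"
    and cinner_add_left: "cinner (x + y) z = cinner x z + cinner y z"
    and cinner_scaleC_left: "cinner (c *\<^sub>C x) y = c * cinner x y"
    and cinner_ge_zero: "0 \<le> Re (cinner x x)"
    and cinner_eq_zero_iff: "cinner x x = 0 \<longleftrightarrow> x = 0"
    and norm_eq_sqrt_cinner: "norm x = sqrt (Re (cinner x x))"

class complex_hilbert = complex_inner + complete_space

instantiation complex :: complex_hilbert
begin
definition scaleC_complex :: "complex \<Rightarrow> complex \<Rightarrow> complex" where "scaleC_complex c x = c * x"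
definition cinner_complex :: "complex \<Rightarrow> complex \<Rightarrow> complex" where "cinner_complex x y = x * cnj y"
instance
  by standard
    (auto simp: scaleC_complex_def cinner_complex_def scaleR_conv_of_real algebra_simps
        cmod_def power2_eq_square)
end

section \<open>Sectorial forms\<close>

definition sector :: "real \<Rightarrow> complex set" where
  "sector \<theta> = (if \<theta> = 0 then complex_of_real ` {0<..} else {z. z \<noteq> 0 \<and> \<bar>Arg z\<bar> < \<theta>})"

text \<open>
  A form with domain \<open>D\<close> is represented by a total function whose values outside \<open>D \<times> D\<close> are
  irrelevant.
\<close>

definition sesquilinear_on :: "'a::complex_vector set \<Rightarrow> ('a \<Rightarrow> 'a \<Rightarrow> complex) \<Rightarrow> bool" where
  "sesquilinear_on D a \<longleftrightarrow>
     (\<forall>u\<in>D. \<forall>v\<in>D. \<forall>w\<in>D. a (u + v) w = a u w + a v w) \<and>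
     (\<forall>u\<in>D. \<forall>w\<in>D. \<forall>c. a (c *\<^sub>C u) w = c * a u w) \<and>
     (\<forall>u\<in>D. \<forall>v\<in>D. \<forall>w\<in>D. a u (v + w) = a u v + a u w) \<and>
     (\<forall>u\<in>D. \<forall>w\<in>D. \<forall>c. a u (c *\<^sub>C w) = cnj c * a u w)"

definition sectorial_form ::
  "real \<Rightarrow> 'a::complex_vector set \<Rightarrow> ('a \<Rightarrow> 'a \<Rightarrow> complex) \<Rightarrow> bool" where
  "sectorial_form \<theta> D a \<longleftrightarrow>
     module.subspace scaleC D \<and> sesquilinear_on D a \<and> (\<forall>u\<in>D. a u u \<in> closure (sector \<theta>))"

definition form_norm :: "('a::complex_inner \<Rightarrow> 'a \<Rightarrow> complex) \<Rightarrow> 'a \<Rightarrow> real" where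
  "form_norm a u = sqrt (Re (a u u) + (norm u)\<^sup>2)"

definition closed_sectorial_form ::
  "real \<Rightarrow> 'a::complex_hilbert set \<Rightarrow> ('a \<Rightarrow> 'a \<Rightarrow> complex) \<Rightarrow> bool" where
  "closed_sectorial_form \<theta> D a \<longleftrightarrow>
     sectorial_form \<theta> D a \<and>
     (\<forall>x::nat \<Rightarrow> 'a. range x \<subseteq> D \<and>
        (\<forall>e>0. \<exists>N. \<forall>m\<ge>N. \<forall>n\<ge>N. form_norm a (x m - x n) < e) \<longrightarrow>
        (\<exists>u\<in>D. (\<lambda>n. form_norm a (x n - u)) \<longlonglongrightarrow> 0))"

definition limit_dom ::
  "(nat \<Rightarrow> 'a set) \<Rightarrow> (nat \<Rightarrow> 'a \<Rightarrow> 'a \<Rightarrow> complex) \<Rightarrow> 'a set" where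
  "limit_dom D a = {u \<in> (\<Inter>n. D n). bdd_above (range (\<lambda>n. Re (a n u u)))}"

definition limit_form :: "(nat \<Rightarrow> 'a \<Rightarrow> 'a \<Rightarrow> complex) \<Rightarrow> 'a \<Rightarrow> 'a \<Rightarrow> complex" where
  "limit_form a u v = lim (\<lambda>n. a n u v)"

section \<open>Linear relations\<close>

definition linear_relation :: "('a::complex_vector \<times> 'a) set \<Rightarrow> bool" where
  "linear_relation A \<longleftrightarrow> module.subspace (\<lambda>c p. (c *\<^sub>C fst p, c *\<^sub>C snd p)) A"

definition id_plus :: "('a::complex_vector \<times> 'a) set \<Rightarrow> ('a \<times> 'a) set" where
  "id_plus A = {(x, x + y) |x y. (x, y) \<in> A}"

definition m_sectorial :: "real \<Rightarrow> ('a::complex_hilbert \<times> 'a) set \<Rightarrow> bool" where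
  "m_sectorial \<theta> A \<longleftrightarrow>
     linear_relation A \<and> (\<forall>(x, y)\<in>A. cinner y x \<in> closure (sector \<theta>)) \<and> Range (id_plus A) = UNIV"

definition associated_relation ::
  "'a::complex_hilbert set \<Rightarrow> ('a \<Rightarrow> 'a \<Rightarrow> complex) \<Rightarrow> ('a \<times> 'a) set" where
  "associated_relation D a = {(u, y). u \<in> D \<and> (\<forall>v\<in>D. a u v = cinner y v)}"

text \<open>
  The operator whose graph is \<open>(id_plus A)\<inverse>\<close>; the definite description is meaningful for m-sectorial
  \<open>A\<close>, see \<open>m_sectorial_resolvent_unique\<close> below.
\<close>

definition resolvent :: "('a::complex_hilbert \<times> 'a) set \<Rightarrow> 'a \<Rightarrow> 'a" where
  "resolvent A f = (THE x. (f, x) \<in> (id_plus A)\<inverse>)"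

definition strong_resolvent_conv ::
  "(nat \<Rightarrow> ('a::complex_hilbert \<times> 'a) set) \<Rightarrow> ('a \<times> 'a) set \<Rightarrow> bool" where
  "strong_resolvent_conv A B \<longleftrightarrow> (\<forall>f. (\<lambda>n. resolvent (A n) f) \<longlonglongrightarrow> resolvent B f)"

section \<open>Well-definedness of the notions above\<close>

lemma vector_space_scaleC: "vector_space (scaleC :: complex \<Rightarrow> 'a::complex_vector \<Rightarrow> 'a)"
  by standard (simp_all add: scaleC_add_right scaleC_add_left scaleC_scaleC scaleC_one)

lemma vector_space_scaleC_prod:
  "vector_space (\<lambda>c (p :: 'a::complex_vector \<times> 'a). (c *\<^sub>C fst p, c *\<^sub>C snd p))"
  by standard (simp_all add: scaleC_add_right scaleC_add_left scaleC_scaleC scaleC_one)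

lemmas subspace_scaleC_iff = module.subspace_def[OF
  vector_space_scaleC[folded module_iff_vector_space]]

lemmas linear_relation_iff = linear_relation_def[unfolded module.subspace_def[OF
  vector_space_scaleC_prod[folded module_iff_vector_space]]]

lemma closure_sector_Re_nonneg:
  assumes "\<theta> < pi / 2" and "z \<in> closure (sector \<theta>)"
  shows "0 \<le> Re z"
proof -
  have "sector \<theta> \<subseteq> {z. 0 \<le> Re z}"
  proof
    fix w assume w: "w \<in> sector \<theta>"
    show "w \<in> {z. 0 \<le> Re z}"
    proof (cases "\<theta> = 0")
      case True
      then show ?thesis using w by (auto simp: sector_def)
    next
      case False
      then have "w \<noteq> 0" "\<bar>Arg w\<bar> < pi / 2" using w assms(1) by (auto simp: sector_def)
      then have "0 < Re w" using Re_Ln_pos_lt[of w] by (simp add: Arg_eq_Im_Ln)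
      then show ?thesis by simp
    qed
  qed
  moreover have "closed {z. 0 \<le> Re z}" by (rule closed_halfspace_Re_ge)
  ultimately show ?thesis using closure_minimal assms(2) by blast
qed

lemma scaleC_minus_one: "(- 1) *\<^sub>C (x::'a::complex_vector) = - x"
  by (metis of_real_1 of_real_minus scaleR_minus1_left scaleR_scaleC)

lemma cinner_minus_left: "cinner (- (x::'a::complex_inner)) y = - cinner x y"
  using cinner_scaleC_left[of "- 1" x y] by (simp add: scaleC_minus_one)

lemma power2_norm_eq_cinner: "(norm (x::'a::complex_inner))\<^sup>2 = Re (cinner x x)"
  by (simp add: norm_eq_sqrt_cinner cinner_ge_zero)

lemma m_sectorial_resolvent_unique:
  assumes "\<theta> < pi / 2" and "m_sectorial \<theta> A"
  shows "\<exists>!x. (f, x) \<in> (id_plus A)\<inverse>"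
proof -
  have A: "linear_relation A" "\<And>x y. (x, y) \<in> A \<Longrightarrow> cinner y x \<in> closure (sector \<theta>)"
    and R: "f \<in> Range (id_plus A)"
    using assms(2) by (auto simp: m_sectorial_def)
  have "x = x'" if x: "(x, y) \<in> A" and x': "(x', y') \<in> A" and f: "x + y = x' + y'" for x y x' y'
  proof -
    have "(- x', - y') \<in> A"
      using A(1) x' unfolding linear_relation_iff
      by (metis fst_conv scaleC_minus_one snd_conv)
    then have "(x + - x', y + - y') \<in> A"
      using A(1) x unfolding linear_relation_iff by (metis add_Pair)
    moreover have "y + - y' = - (x + - x')" using f by (simp add: algebra_simps)
    ultimately have "0 \<le> Re (cinner (- (x + - x')) (x + - x'))"
      using A(2) closure_sector_Re_nonneg[OF assms(1)] by metis
    then have "(norm (x - x'))\<^sup>2 \<le> 0"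
      by (simp only: cinner_minus_left power2_norm_eq_cinner) simp
    then show ?thesis by simp
  qed
  then show ?thesis using R unfolding id_plus_def by fastforce
qed

end

theory Submission
  imports Defs
begin

text \<open>
  Put \<open>b\<^sub>n = a\<^sub>n + (\<cdot>|\<cdot>)\<close> and let \<open>u\<^sub>n\<close>, \<open>u\<close> solve \<open>b\<^sub>n(u\<^sub>n, v) = (f|v)\<close> on \<open>dom(a\<^sub>n)\<close> and
  \<open>b(u, v) = (f|v)\<close> on \<open>dom(a)\<close>, which is possible by Lax--Milgram. With \<open>\<Psi>\<^sub>n = b\<^sub>n(u, \<cdot>) - (f|\<cdot>)\<close> one has
  \<open>Re b\<^sub>n(u - u\<^sub>n) = Re \<Psi>\<^sub>n(u - u\<^sub>n)\<close>, so it suffices that the dual norm of \<open>\<Psi>\<^sub>n\<close> with respect to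
  \<open>Re b\<^sub>n\<close> tends to \<open>0\<close>. Sectoriality of the differences makes \<open>\<Psi>\<^sub>n - \<Psi>\<^sub>m\<close> small uniformly in
  \<open>n \<ge> m\<close>, and makes \<open>\<Psi>\<^sub>m\<close> small on \<open>dom(a)\<close>. That smallness on \<open>dom(a)\<close> passes to \<open>dom(a\<^sub>n)\<close> for
  large \<open>n\<close>: by the parallelogram law and monotonicity, near-minimizers \<open>v\<^sub>n\<close> of
  \<open>Re b\<^sub>n(v) - 2 Re \<Psi>\<^sub>m(v)\<close> converge to an element of \<open>dom(a)\<close>. No weak compactness is needed, and
  the same minimization for a constant sequence yields the Riesz representation behind Lax--Milgram.
\<close>

section \<open>Forms controlled by their real part\<close>

text \<open>On the sector \<open>\<bar>Im z\<bar> \<le> tan \<theta> * Re z\<close> and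
  \<open>0 \<le> Re z\<close>. Both are closed conditions, so they survive the closure, and
  \<open>cmod z\<close> is at most the sum of the absolute values of the two parts.\<close>

lemma closure_sector_bound:
  assumes "0 \<le> \<theta>" "\<theta> < pi / 2" "z \<in> closure (sector \<theta>)"
  shows "cmod z \<le> (1 + tan \<theta>) * Re z"
proof -
  have "\<bar>Im w\<bar> \<le> tan \<theta> * Re w \<and> 0 \<le> Re w" if w: "w \<in> sector \<theta>" for w
  proof (cases "\<theta> = 0")
    case True
    then show ?thesis using w by (auto simp: sector_def)
  next
    case False
    then have A: "w \<noteq> 0" "\<bar>Arg w\<bar> < \<theta>" using w by (auto simp: sector_def)
    have w_eq: "w = rcis (cmod w) (Arg w)" by (simp add: rcis_cmod_Arg)
    have Re: "Re w = cmod w * cos (Arg w)" and Im: "Im w = cmod w * sin (Arg w)"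
      by (metis w_eq Re_rcis, metis w_eq Im_rcis)
    have cos: "0 < cos (Arg w)" using A(2) assms(2) by (intro cos_gt_zero_pi) auto
    have "\<bar>tan (Arg w)\<bar> \<le> tan \<theta>"
    proof -
      have "tan (Arg w) \<le> tan \<theta>" "tan (- \<theta>) \<le> tan (Arg w)"
        using A(2) assms(2) by (intro tan_mono_le; simp; fail)+
      then show ?thesis by simp
    qed
    then have "\<bar>sin (Arg w)\<bar> \<le> tan \<theta> * cos (Arg w)"
      using cos by (simp add: tan_def abs_mult abs_divide divide_le_eq)
    then have "\<bar>Im w\<bar> \<le> tan \<theta> * Re w"
      unfolding Re Im by (simp add: abs_mult mult_left_mono mult.left_commute)
    then show ?thesis using cos by (simp add: Re)
  qed
  then have "sector \<theta> \<subseteq> {z. \<bar>Im z\<bar> \<le> tan \<theta> * Re z \<and> 0 \<le> Re z}" by blast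
  moreover have "closed {z. \<bar>Im z\<bar> \<le> tan \<theta> * Re z \<and> 0 \<le> Re z}"
    by (intro closed_Collect_conj closed_Collect_le continuous_intros)
  ultimately have "\<bar>Im z\<bar> \<le> tan \<theta> * Re z" "0 \<le> Re z"
    using closure_minimal assms(3) by blast+
  then show ?thesis using cmod_le[of z] by (simp add: algebra_simps)
qed

text \<open>Optimization over the free weight: \<open>r = x / (2 * A)\<close> turns the bound into
  \<open>x \<le> x / 2 + 2 * A * B / x\<close>.\<close>

lemma square_le_of_AM_GM:
  fixes x A B :: real
  assumes "0 \<le> A" "0 \<le> B" "0 \<le> x" and "\<And>r. 0 < r \<Longrightarrow> x \<le> r * A + B / r"
  shows "x\<^sup>2 \<le> 4 * A * B"
proof (cases "x = 0")
  case False
  then have x: "0 < x" using assms by simp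
  show ?thesis
  proof (cases "A = 0")
    case True
    \<comment> \<open>Without the first term a large weight is contradictory: this \<open>r\<close>
      gives \<open>x \<le> x / 2\<close>.\<close>
    show ?thesis using assms(4)[of "2 * (B + 1) / x"] x assms(2) True
      mult_nonneg_nonneg[OF assms(2,3)] by (simp add: field_simps)
  next
    case False
    then show ?thesis using assms(1) assms(4)[of "x / (2 * A)"] x
      by (simp add: field_simps power2_eq_square)
  qed
qed (use assms in auto)

locale sesq =
  fixes D :: "'a::complex_vector set" and b :: "'a \<Rightarrow> 'a \<Rightarrow> complex"
  assumes subspace: "module.subspace scaleC D" and sesquilinear: "sesquilinear_on D b"
begin

lemma mem_0: "0 \<in> D"
  and mem_add: "u \<in> D \<Longrightarrow> v \<in> D \<Longrightarrow> u + v \<in> D"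
  and mem_scaleC: "u \<in> D \<Longrightarrow> c *\<^sub>C u \<in> D"
  using subspace by (auto simp: subspace_scaleC_iff)

lemma mem_scaleR: "u \<in> D \<Longrightarrow> r *\<^sub>R u \<in> D"
  by (simp add: scaleR_scaleC mem_scaleC)

lemma mem_diff: "u \<in> D \<Longrightarrow> v \<in> D \<Longrightarrow> u - v \<in> D"
  using mem_add[of u "(-1) *\<^sub>R v"] mem_scaleR[of v "-1"] by simp

lemma add_left: "u \<in> D \<Longrightarrow> v \<in> D \<Longrightarrow> w \<in> D \<Longrightarrow> b (u + v) w = b u w + b v w"
  and add_right: "u \<in> D \<Longrightarrow> v \<in> D \<Longrightarrow> w \<in> D \<Longrightarrow> b u (v + w) = b u v + b u w"
  and scaleC_left: "u \<in> D \<Longrightarrow> v \<in> D \<Longrightarrow> b (c *\<^sub>C u) v = c * b u v"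
  and scaleC_right: "u \<in> D \<Longrightarrow> v \<in> D \<Longrightarrow> b u (c *\<^sub>C v) = cnj c * b u v"
  using sesquilinear by (auto simp: sesquilinear_on_def)

lemma scaleR_left: "u \<in> D \<Longrightarrow> v \<in> D \<Longrightarrow> b (r *\<^sub>R u) v = of_real r * b u v"
  and scaleR_right: "u \<in> D \<Longrightarrow> v \<in> D \<Longrightarrow> b u (r *\<^sub>R v) = of_real r * b u v"
  by (simp_all add: scaleR_scaleC scaleC_left scaleC_right)

lemma diff_left: "u \<in> D \<Longrightarrow> v \<in> D \<Longrightarrow> w \<in> D \<Longrightarrow> b (u - v) w = b u w - b v w"
  using add_left[of "u - v" v w] mem_diff by simp

lemma diff_right: "u \<in> D \<Longrightarrow> v \<in> D \<Longrightarrow> w \<in> D \<Longrightarrow> b u (v - w) = b u v - b u w"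
  using add_right[of u "v - w" w] mem_diff by simp

lemmas form_simps = mem_add mem_diff mem_scaleC mem_scaleR add_left add_right diff_left diff_right
  scaleC_left scaleC_right scaleR_left scaleR_right

lemma diff_commute: "u \<in> D \<Longrightarrow> v \<in> D \<Longrightarrow> b (u - v) (u - v) = b (v - u) (v - u)"
  by (simp add: form_simps)

lemma parallelogram:
  "u \<in> D \<Longrightarrow> v \<in> D \<Longrightarrow> b (u + v) (u + v) + b (u - v) (u - v) = 2 * b u u + 2 * b v v"
  by (simp add: form_simps)

lemma polarization:
  assumes "u \<in> D" "v \<in> D"
  shows "4 * b u v = b (u + v) (u + v) - b (u - v) (u - v) +
    \<i> * b (u + \<i> *\<^sub>C v) (u + \<i> *\<^sub>C v) - \<i> * b (u - \<i> *\<^sub>C v) (u - \<i> *\<^sub>C v)"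
  using assms by (simp add: form_simps algebra_simps)

end

text \<open>Sectoriality is recorded only through this diagonal bound. It is additive, so sums of
  forms keep the same \<open>M\<close>. Given forms have \<open>M = 1 + tan \<theta>\<close>; inner
  products have \<open>M = 1\<close>.\<close>

locale sform = sesq +
  fixes M :: real
  assumes M_pos: "0 < M" and bound: "u \<in> D \<Longrightarrow> cmod (b u u) \<le> M * Re (b u u)"
begin

lemma Re_nonneg: "u \<in> D \<Longrightarrow> 0 \<le> Re (b u u)"
  using bound[of u] M_pos norm_ge_zero[of "b u u"] by (smt (verit) mult_pos_neg)

lemma Re_add_le: "u \<in> D \<Longrightarrow> v \<in> D \<Longrightarrow> Re (b (u + v) (u + v)) \<le> 2 * Re (b u u) + 2 * Re (b v v)"
  using arg_cong[OF parallelogram, of u v Re] Re_nonneg[of "u - v"] mem_diff by simp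

lemma Re_diff_le: "u \<in> D \<Longrightarrow> v \<in> D \<Longrightarrow> Re (b (u - v) (u - v)) \<le> 2 * Re (b u u) + 2 * Re (b v v)"
  using arg_cong[OF parallelogram, of u v Re] Re_nonneg[of "u + v"] mem_add by simp

text \<open>Polarization reduces \<open>b u v\<close> to four diagonal values. The sector bound
  replaces these by their real parts, which two parallelogram laws, for \<open>v\<close> and for
  \<open>\<i> *\<^sub>C v\<close>, add up.\<close>

lemma cmod_le_sum:
  assumes "u \<in> D" "v \<in> D"
  shows "cmod (b u v) \<le> M * (Re (b u u) + Re (b v v))"
proof -
  let ?w = "\<i> *\<^sub>C v"
  have w: "?w \<in> D" using assms by (simp add: mem_scaleC)
  have "4 * cmod (b u v) = cmod (4 * b u v)" by (simp add: norm_mult)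
  also have "\<dots> \<le> cmod (b (u + v) (u + v)) + cmod (b (u - v) (u - v)) +
      cmod (\<i> * b (u + ?w) (u + ?w)) + cmod (\<i> * b (u - ?w) (u - ?w))"
    unfolding polarization[OF assms]
    by (smt (verit) norm_triangle_ineq norm_triangle_ineq4)
  also have "\<dots> = cmod (b (u + v) (u + v)) + cmod (b (u - v) (u - v)) +
      cmod (b (u + ?w) (u + ?w)) + cmod (b (u - ?w) (u - ?w))"
    by (simp add: norm_mult)
  also have "\<dots> \<le> M * Re (b (u + v) (u + v)) + M * Re (b (u - v) (u - v)) +
      M * Re (b (u + ?w) (u + ?w)) + M * Re (b (u - ?w) (u - ?w))"
    using assms w by (intro add_mono bound mem_add mem_diff)
  also have "\<dots> = M * Re ((b (u + v) (u + v) + b (u - v) (u - v)) +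
      (b (u + ?w) (u + ?w) + b (u - ?w) (u - ?w)))"
    by (simp add: algebra_simps)
  also have "\<dots> = 4 * (M * (Re (b u u) + Re (b v v)))"
    unfolding parallelogram[OF assms] parallelogram[OF assms(1) w]
    using assms by (simp add: form_simps algebra_simps)
  finally show ?thesis by simp
qed

text \<open>The value \<open>b u v\<close> is unchanged when \<open>u\<close> is scaled by
  \<open>sqrt r\<close> and \<open>v\<close> by its inverse.\<close>

lemma cmod_le_AM_GM:
  assumes "u \<in> D" "v \<in> D" "0 < r"
  shows "cmod (b u v) \<le> M * (r * Re (b u u) + Re (b v v) / r)"
proof -
  define s where "s = sqrt r"
  have s: "0 < s" "s * s = r" using assms by (simp_all add: s_def)
  have "b u v = b (s *\<^sub>R u) ((1 / s) *\<^sub>R v)" using s assms by (simp add: form_simps)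
  also have "cmod \<dots> \<le> M * (r * Re (b u u) + Re (b v v) / r)"
    using cmod_le_sum[of "s *\<^sub>R u" "(1 / s) *\<^sub>R v"] s assms
    by (simp add: form_simps mult.assoc[symmetric])
  finally show ?thesis .
qed

text \<open>Optimizing \<open>r\<close> in the previous bound gives a Cauchy--Schwarz inequality for
  a form that need not be hermitian; the price is the factor \<open>4 * M\<^sup>2\<close>.\<close>

lemma Cauchy_Schwarz:
  assumes "u \<in> D" "v \<in> D"
  shows "(cmod (b u v))\<^sup>2 \<le> 4 * M\<^sup>2 * Re (b u u) * Re (b v v)"
proof -
  have "(cmod (b u v))\<^sup>2 \<le> 4 * (M * Re (b u u)) * (M * Re (b v v))"
    using assms Re_nonneg M_pos cmod_le_AM_GM[OF assms]
    by (intro square_le_of_AM_GM) (auto simp: algebra_simps)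
  then show ?thesis by (simp add: power2_eq_square algebra_simps)
qed

text \<open>Expand at \<open>x k = w + (x k - w)\<close>. The two mixed terms are different numbers,
  as the form is not hermitian, but \<open>Cauchy_Schwarz\<close> sends both to 0. Membership is
  asked for only eventually, because a sequence with \<open>x k \<in> D k\<close> lies in a fixed
  \<open>D m\<close> only from \<open>m\<close> on.\<close>

lemma tendsto_form_self:
  assumes "\<forall>\<^sub>F k in sequentially. x k \<in> D" "w \<in> D"
    and "(\<lambda>k. Re (b (x k - w) (x k - w))) \<longlonglongrightarrow> 0"
  shows "(\<lambda>k. Re (b (x k) (x k))) \<longlonglongrightarrow> Re (b w w)"
proof -
  let ?d = "\<lambda>k. x k - w"
  have sq: "(\<lambda>k. 4 * M\<^sup>2 * Re (b w w) * Re (b (?d k) (?d k))) \<longlonglongrightarrow> 0"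
    using tendsto_mult_left[OF assms(3), of "4 * M\<^sup>2 * Re (b w w)"] by simp
  have wd: "(\<lambda>k. b w (?d k)) \<longlonglongrightarrow> 0"
  proof -
    have "(\<lambda>k. (cmod (b w (?d k)))\<^sup>2) \<longlonglongrightarrow> 0"
      using assms(1) Cauchy_Schwarz[OF assms(2)] assms(2)
      by (intro Lim_null_comparison[OF _ sq]) (auto elim!: eventually_mono simp: mem_diff)
    then show ?thesis by (simp add: tendsto_norm_zero_iff)
  qed
  have dw: "(\<lambda>k. b (?d k) w) \<longlonglongrightarrow> 0"
  proof -
    have "(cmod (b u w))\<^sup>2 \<le> 4 * M\<^sup>2 * Re (b w w) * Re (b u u)" if "u \<in> D" for u
      using Cauchy_Schwarz[OF that assms(2)] by (simp add: algebra_simps)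
    then have "(\<lambda>k. (cmod (b (?d k) w))\<^sup>2) \<longlonglongrightarrow> 0"
      using assms(1,2)
      by (intro Lim_null_comparison[OF _ sq]) (auto elim!: eventually_mono simp: mem_diff)
    then show ?thesis by (simp add: tendsto_norm_zero_iff)
  qed
  have "(\<lambda>k. Re (b w w) + Re (b w (?d k)) + Re (b (?d k) w) + Re (b (?d k) (?d k)))
      \<longlonglongrightarrow> Re (b w w) + Re 0 + Re 0 + 0"
    by (intro tendsto_intros wd dw assms(3))
  moreover have "\<forall>\<^sub>F k in sequentially.
     Re (b w w) + Re (b w (?d k)) + Re (b (?d k) w) + Re (b (?d k) (?d k)) = Re (b (x k) (x k))"
    using assms(1) by eventually_elim (use assms(2) in \<open>simp add: form_simps\<close>)
  ultimately show ?thesis by (simp add: tendsto_cong)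
qed

end

lemma sform_add:
  assumes "sform D b M" "sform D b' M"
  shows "sform D (\<lambda>u v. b u v + b' u v) M"
proof -
  interpret b: sform D b M by fact
  interpret b': sform D b' M by fact
  show ?thesis
  proof
    show "sesquilinear_on D (\<lambda>u v. b u v + b' u v)"
      unfolding sesquilinear_on_def by (simp add: b.form_simps b'.form_simps algebra_simps)
    show "cmod (b u u + b' u u) \<le> M * Re (b u u + b' u u)" if "u \<in> D" for u
      using b.bound[OF that] b'.bound[OF that] norm_triangle_ineq[of "b u u" "b' u u"]
      by (simp add: algebra_simps)
  qed (rule b.subspace b.M_pos)+
qed

lemma sform_subset:
  assumes "sform D b M" "module.subspace scaleC D'" "D' \<subseteq> D"
  shows "sform D' b M"
proof -
  interpret sform D b M by fact
  show ?thesis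
  proof
    show "sesquilinear_on D' b"
      using assms(3) sesquilinear unfolding sesquilinear_on_def by (meson subsetD)
  qed (use assms M_pos bound in auto)
qed

text \<open>Completeness for the seminorm \<open>sqrt (Re (b u u))\<close>, written with its square
  to avoid roots.\<close>

definition complete_form :: "'a::complex_inner set \<Rightarrow> ('a \<Rightarrow> 'a \<Rightarrow> complex) \<Rightarrow> bool" where
  "complete_form D b \<longleftrightarrow> (\<forall>x::nat \<Rightarrow> 'a. range x \<subseteq> D \<and>
     (\<forall>e>0. \<exists>N. \<forall>m\<ge>N. \<forall>n\<ge>N. Re (b (x m - x n) (x m - x n)) < e) \<longrightarrow>
     (\<exists>u\<in>D. (\<lambda>n. Re (b (x n - u) (x n - u))) \<longlonglongrightarrow> 0))"

text \<open>The domain becomes a Hilbert space continuously embedded in the ambient one. A form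
  shifted by the inner product has \<open>K = 1\<close>; a general \<open>K\<close> accommodates the
  auxiliary inner product \<open>p\<close> in \<open>Lax_Milgram\<close>.\<close>

locale hform = sform D b M for D :: "'a::complex_inner set" and b M +
  fixes K :: real
  assumes K_nonneg: "0 \<le> K" and coercive: "u \<in> D \<Longrightarrow> (norm u)\<^sup>2 \<le> K * Re (b u u)"
    and complete: "complete_form D b"
begin

lemma eq_0: "u \<in> D \<Longrightarrow> Re (b u u) = 0 \<Longrightarrow> u = 0"
  using coercive[of u] by simp

lemma tendsto_in_norm:
  assumes "\<forall>\<^sub>F k in sequentially. x k \<in> D" "w \<in> D"
    and "(\<lambda>k. Re (b (x k - w) (x k - w))) \<longlonglongrightarrow> 0"
  shows "x \<longlonglongrightarrow> w"
proof -
  have "(\<lambda>k. K * Re (b (x k - w) (x k - w))) \<longlonglongrightarrow> 0"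
    using tendsto_mult_left[OF assms(3), of K] by simp
  then have "(\<lambda>k. (norm (x k - w))\<^sup>2) \<longlonglongrightarrow> 0"
    by (rule Lim_null_comparison[rotated])
      (use assms(1) in eventually_elim, use assms(2) coercive in \<open>auto simp: mem_diff\<close>)
  then show ?thesis by (simp add: tendsto_norm_zero_iff Lim_null[symmetric])
qed

end

section \<open>Monotone sequences of forms\<close>

text \<open>The constants are uniform in \<open>n\<close>. Constant sequences and shifted tails are
  instances as well; \<open>Riesz_real_part\<close> uses the former, \<open>dual_bound\<close> the
  latter.\<close>

locale mono_forms =
  fixes D :: "nat \<Rightarrow> 'a::complex_hilbert set" and b :: "nat \<Rightarrow> 'a \<Rightarrow> 'a \<Rightarrow> complex" and M K :: real
  assumes hform: "hform (D n) (b n) M K"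
    and dom_Suc: "D (Suc n) \<subseteq> D n"
    and diff_Suc: "sform (D (Suc n)) (\<lambda>u v. b (Suc n) u v - b n u v) M"
begin

sublocale form: hform "D n" "b n" M K for n
  by (rule hform)

abbreviation E where "E \<equiv> limit_dom D b"
abbreviation b_lim where "b_lim \<equiv> limit_form b"

lemma dom_mono: "m \<le> n \<Longrightarrow> D n \<subseteq> D m"
  using decseqD decseq_SucI dom_Suc by metis

text \<open>The difference telescopes into increments, restricted to the smallest domain; adding
  them does not enlarge \<open>M\<close>.\<close>

lemma diff_form: "m \<le> n \<Longrightarrow> sform (D n) (\<lambda>u v. b n u v - b m u v) M"
proof (induction n rule: dec_induct)
  case base
  show ?case
    by standard (auto simp: sesquilinear_on_def form.subspace form.M_pos)
next
  case (step n)
  have "sform (D (Suc n)) (\<lambda>u v. (b (Suc n) u v - b n u v) + (b n u v - b m u v)) M"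
    by (intro sform_add diff_Suc sform_subset[OF step.IH] form.subspace dom_Suc)
  then show ?case by simp
qed

lemma form_mono: "m \<le> n \<Longrightarrow> u \<in> D n \<Longrightarrow> Re (b m u u) \<le> Re (b n u u)"
  using sform.Re_nonneg[OF diff_form, of m n u] by simp

section \<open>The domain of the limit and the limit form\<close>

lemma limit_dom_subset: "E \<subseteq> D n"
  by (auto simp: limit_dom_def)

lemma limit_domI: "(\<And>n. u \<in> D n) \<Longrightarrow> (\<And>n. Re (b n u u) \<le> B) \<Longrightarrow> u \<in> E"
  by (auto simp: limit_dom_def intro!: bdd_aboveI2)

lemma limit_dom_incseq: "u \<in> E \<Longrightarrow> incseq (\<lambda>n. Re (b n u u))"
  by (auto simp: incseq_def intro!: form_mono subsetD[OF limit_dom_subset])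

lemma limit_dom_convergent_Re: "u \<in> E \<Longrightarrow> convergent (\<lambda>n. Re (b n u u))"
proof -
  assume u: "u \<in> E"
  then obtain B where "\<And>n. Re (b n u u) \<le> B"
    by (auto simp: limit_dom_def bdd_above_def)
  then show ?thesis using incseq_convergent[OF limit_dom_incseq[OF u]] convergentI by metis
qed

text \<open>By \<open>cmod_le_sum\<close> for the difference form, off-diagonal increments are at
  most \<open>M\<close> times the increments of the two diagonal real parts, which converge by
  monotonicity and boundedness.\<close>

lemma limit_form_convergent:
  assumes "u \<in> E" "v \<in> E"
  shows "convergent (\<lambda>n. b n u v)"
proof -
  let ?s = "\<lambda>n. Re (b n u u) + Re (b n v v)"
  have le: "dist (b n u v) (b m u v) \<le> M * dist (?s n) (?s m)" if "m \<le> n" for m n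
  proof -
    interpret d: sform "D n" "\<lambda>u v. b n u v - b m u v" M by (rule diff_form) fact
    have uv: "u \<in> D n" "v \<in> D n" using assms limit_dom_subset by auto
    show ?thesis
      using d.cmod_le_sum[OF uv] form_mono[OF that, of u] form_mono[OF that, of v] uv
      by (simp add: dist_norm algebra_simps)
  qed
  have "Cauchy (\<lambda>n. b n u v)"
  proof (rule metric_CauchyI)
    fix e :: real assume "0 < e"
    then have e: "0 < e / M" using form.M_pos by simp
    have "Cauchy ?s"
      by (intro convergent_Cauchy convergent_add limit_dom_convergent_Re assms)
    from metric_CauchyD[OF this e]
    obtain N where N: "\<And>m n. m \<ge> N \<Longrightarrow> n \<ge> N \<Longrightarrow> dist (?s m) (?s n) < e / M" by blast
    have *: "dist (b n u v) (b m u v) < e" if "m \<le> n" "m \<ge> N" for m n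
    proof -
      have "M * dist (?s n) (?s m) < e"
        using N[of n m] that form.M_pos by (simp add: field_simps)
      then show ?thesis using le[OF that(1)] by simp
    qed
    show "\<exists>N. \<forall>m\<ge>N. \<forall>n\<ge>N. dist (b m u v) (b n u v) < e"
      using * by (metis dist_commute nle_le)
  qed
  then show ?thesis by (simp add: Cauchy_convergent_iff)
qed

lemma limit_form_tendsto: "u \<in> E \<Longrightarrow> v \<in> E \<Longrightarrow> (\<lambda>n. b n u v) \<longlonglongrightarrow> b_lim u v"
  unfolding limit_form_def using limit_form_convergent convergent_LIMSEQ_iff by blast

lemma limit_form_tendsto_Re: "u \<in> E \<Longrightarrow> (\<lambda>n. Re (b n u u)) \<longlonglongrightarrow> Re (b_lim u u)"
  by (intro tendsto_Re limit_form_tendsto)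

lemma limit_form_ge: "u \<in> E \<Longrightarrow> Re (b n u u) \<le> Re (b_lim u u)"
  using incseq_le limit_dom_incseq limit_form_tendsto_Re by blast

lemma limit_dom_add: "u \<in> E \<Longrightarrow> v \<in> E \<Longrightarrow> u + v \<in> E"
proof (rule limit_domI)
  assume E: "u \<in> E" "v \<in> E"
  then have D: "u \<in> D n" "v \<in> D n" for n using limit_dom_subset by auto
  show "u + v \<in> D n" for n using D by (rule form.mem_add)
  show "Re (b n (u + v) (u + v)) \<le> 2 * Re (b_lim u u) + 2 * Re (b_lim v v)" for n
    using form.Re_add_le[OF D] limit_form_ge[OF E(1)] limit_form_ge[OF E(2)]
    by (smt (verit))
qed

lemma limit_dom_scaleC: "u \<in> E \<Longrightarrow> c *\<^sub>C u \<in> E"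
proof (rule limit_domI)
  assume E: "u \<in> E"
  then have D: "u \<in> D n" for n using limit_dom_subset by auto
  show "c *\<^sub>C u \<in> D n" for n using D by (rule form.mem_scaleC)
  show "Re (b n (c *\<^sub>C u) (c *\<^sub>C u)) \<le> (cmod c)\<^sup>2 * Re (b_lim u u)" for n
  proof -
    have "b n (c *\<^sub>C u) (c *\<^sub>C u) = of_real ((cmod c)\<^sup>2) * b n u u"
      using D by (simp add: form.form_simps complex_norm_square mult.assoc[symmetric] del: of_real_power)
    then show ?thesis using limit_form_ge[OF E] by (simp add: mult_left_mono)
  qed
qed

lemma limit_dom_subspace: "module.subspace scaleC E"
proof -
  have "0 \<in> E"
    using form.diff_left[of 0 _ 0 0] form.mem_0 by (intro limit_domI[of _ 0]) auto
  then show ?thesis by (simp add: subspace_scaleC_iff limit_dom_add limit_dom_scaleC)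
qed

sublocale lim: sform E b_lim M
proof
  show "sesquilinear_on E b_lim"
    unfolding sesquilinear_on_def
  proof (intro conjI ballI allI)
    fix u v w assume E: "u \<in> E" "v \<in> E" "w \<in> E"
    then have D: "u \<in> D n" "v \<in> D n" "w \<in> D n" for n using limit_dom_subset by auto
    have "(\<lambda>n. b n (u + v) w) \<longlonglongrightarrow> b_lim u w + b_lim v w"
      using tendsto_add[OF limit_form_tendsto limit_form_tendsto, OF E(1,3) E(2,3)]
      by (simp add: form.form_simps D)
    then show "b_lim (u + v) w = b_lim u w + b_lim v w"
      by (rule LIMSEQ_unique[OF limit_form_tendsto[OF limit_dom_add[OF E(1,2)] E(3)]])
    have "(\<lambda>n. b n u (v + w)) \<longlonglongrightarrow> b_lim u v + b_lim u w"
      using tendsto_add[OF limit_form_tendsto limit_form_tendsto, OF E(1,2) E(1,3)]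
      by (simp add: form.form_simps D)
    then show "b_lim u (v + w) = b_lim u v + b_lim u w"
      by (rule LIMSEQ_unique[OF limit_form_tendsto[OF E(1) limit_dom_add[OF E(2,3)]]])
  next
    fix u w c assume E: "u \<in> E" "w \<in> E"
    then have D: "u \<in> D n" "w \<in> D n" for n using limit_dom_subset by auto
    have "(\<lambda>n. b n (c *\<^sub>C u) w) \<longlonglongrightarrow> c * b_lim u w"
      using tendsto_mult_left[OF limit_form_tendsto, OF E]
      by (simp add: form.form_simps D)
    then show "b_lim (c *\<^sub>C u) w = c * b_lim u w"
      by (rule LIMSEQ_unique[OF limit_form_tendsto[OF limit_dom_scaleC[OF E(1)] E(2)]])
    have "(\<lambda>n. b n u (c *\<^sub>C w)) \<longlonglongrightarrow> cnj c * b_lim u w"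
      using tendsto_mult_left[OF limit_form_tendsto, OF E]
      by (simp add: form.form_simps D)
    then show "b_lim u (c *\<^sub>C w) = cnj c * b_lim u w"
      by (rule LIMSEQ_unique[OF limit_form_tendsto[OF E(1) limit_dom_scaleC[OF E(2)]]])
  qed
  show "cmod (b_lim u u) \<le> M * Re (b_lim u u)" if "u \<in> E" for u
    by (rule LIMSEQ_le[OF tendsto_norm[OF limit_form_tendsto[OF that that]]
          tendsto_mult_left[OF limit_form_tendsto_Re[OF that]]])
      (use form.bound[OF subsetD[OF limit_dom_subset that]] in blast)
qed (rule limit_dom_subspace form.M_pos)+

text \<open>Each complete space \<open>D m\<close> supplies its own limit of the sequence;
  coercivity makes every one of them the limit in the ambient norm, so they all coincide.\<close>

lemma common_limit:
  assumes mem: "\<And>k. x k \<in> D k"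
    and Cauchy: "\<And>m e. 0 < e \<Longrightarrow>
      \<exists>N\<ge>m. \<forall>k\<ge>N. \<forall>l\<ge>N. Re (b m (x k - x l) (x k - x l)) < e"
  obtains w where "\<And>m. w \<in> D m"
    and "\<And>m. (\<lambda>k. Re (b m (x k - w) (x k - w))) \<longlonglongrightarrow> 0"
proof -
  have ev: "\<forall>\<^sub>F k in sequentially. x k \<in> D m" for m
    using eventually_ge_at_top[of m] by eventually_elim (use mem dom_mono in blast)
  have "\<exists>w\<in>D m. (\<lambda>k. Re (b m (x k - w) (x k - w))) \<longlonglongrightarrow> 0" for m
  proof -
    \<comment> \<open>The shift by \<open>m\<close> puts all members into
      \<open>D m\<close>.\<close>
    let ?y = "\<lambda>k. x (k + m)"
    have "range ?y \<subseteq> D m" using mem dom_mono by (blast intro: le_add2)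
    moreover have "\<forall>e>0. \<exists>N. \<forall>k\<ge>N. \<forall>l\<ge>N. Re (b m (?y k - ?y l) (?y k - ?y l)) < e"
      using Cauchy[of _ m] by (meson trans_le_add1)
    ultimately obtain w where "w \<in> D m" "(\<lambda>k. Re (b m (?y k - w) (?y k - w))) \<longlonglongrightarrow> 0"
      using form.complete[of m] unfolding complete_form_def by blast
    then show ?thesis
      using LIMSEQ_offset[of "\<lambda>k. Re (b m (x k - w) (x k - w))" m 0] by blast
  qed
  then obtain w where w: "\<And>m. w m \<in> D m"
      "\<And>m. (\<lambda>k. Re (b m (x k - w m) (x k - w m))) \<longlonglongrightarrow> 0"
    by metis
  have lim: "x \<longlonglongrightarrow> w m" for m using form.tendsto_in_norm[OF ev w] .
  have eq: "w m = w 0" for m by (rule LIMSEQ_unique[OF lim lim])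
  show ?thesis
  proof (rule that)
    show "w 0 \<in> D m" for m using w(1)[of m] by (simp only: eq[of m])
    show "(\<lambda>k. Re (b m (x k - w 0) (x k - w 0))) \<longlonglongrightarrow> 0" for m
      using w(2)[of m] by (simp only: eq[of m])
  qed
qed

text \<open>Coercivity is inherited from \<open>b 0\<close>. For completeness, a Cauchy sequence for
  \<open>b_lim\<close> is Cauchy for every \<open>b m\<close> with thresholds independent of
  \<open>m\<close>, so its common limit is approached uniformly in \<open>m\<close>.\<close>

sublocale lim: hform E b_lim M K
proof
  show "0 \<le> K" by (rule form.K_nonneg)
  show "(norm u)\<^sup>2 \<le> K * Re (b_lim u u)" if "u \<in> E" for u
    using form.coercive[of u 0] limit_form_ge[OF that, of 0] limit_dom_subset that form.K_nonneg
    by (smt (verit) mult_left_mono subsetD)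
  show "complete_form E b_lim"
    unfolding complete_form_def
  proof (intro allI impI, elim conjE)
    fix x :: "nat \<Rightarrow> 'a"
    assume "range x \<subseteq> E"
      and C: "\<forall>e>0. \<exists>N. \<forall>m\<ge>N. \<forall>n\<ge>N. Re (b_lim (x m - x n) (x m - x n)) < e"
    then have x: "x k \<in> E" for k by auto
    then have xD: "x k \<in> D n" for k n using limit_dom_subset by auto
    obtain w where w: "\<And>m. w \<in> D m"
      "\<And>m. (\<lambda>k. Re (b m (x k - w) (x k - w))) \<longlonglongrightarrow> 0"
    proof (rule common_limit)
      fix m :: nat and e :: real assume "0 < e"
      then obtain N where N: "\<forall>k\<ge>N. \<forall>l\<ge>N. Re (b_lim (x k - x l) (x k - x l)) < e"
        using C by blast
      have "Re (b m (x k - x l) (x k - x l)) < e" if "k \<ge> max m N" "l \<ge> max m N" for k l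
        using N that limit_form_ge[OF lim.mem_diff[OF x x], of m k l]
        by (smt (verit) max.bounded_iff)
      then show "\<exists>N\<ge>m. \<forall>k\<ge>N. \<forall>l\<ge>N. Re (b m (x k - x l) (x k - x l)) < e"
        by (meson max.cobounded1)
    qed (use xD in auto)
    \<comment> \<open>The bound on \<open>x k - x l\<close> is uniform in \<open>m\<close>; letting
      \<open>l\<close> tend to infinity at fixed \<open>m\<close> keeps it.\<close>
    have tail: "\<exists>N. \<forall>k\<ge>N. \<forall>m. Re (b m (x k - w) (x k - w)) \<le> e" if e: "0 < e" for e
    proof -
      obtain N where N: "\<forall>k\<ge>N. \<forall>l\<ge>N. Re (b_lim (x k - x l) (x k - x l)) < e"
        using C e by blast
      have "Re (b m (x k - w) (x k - w)) \<le> e" if k: "k \<ge> N" for k m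
      proof (rule LIMSEQ_le_const2)
        show "(\<lambda>l. Re (b m (x k - x l) (x k - x l))) \<longlonglongrightarrow> Re (b m (x k - w) (x k - w))"
          using w xD by (intro form.tendsto_form_self) (auto simp: form.mem_diff form.diff_commute)
        show "\<exists>N. \<forall>l\<ge>N. Re (b m (x k - x l) (x k - x l)) \<le> e"
          using N k limit_form_ge[OF lim.mem_diff[OF x x], of m k]
          by (meson less_imp_le order.trans)
      qed
      then show ?thesis by blast
    qed
    have xw: "x k - w \<in> E" if "\<forall>m. Re (b m (x k - w) (x k - w)) \<le> e" for k e
      using that w xD by (intro limit_domI[of _ e]) (auto intro: form.mem_diff)
    \<comment> \<open>The uniform bound places \<open>x k - w\<close> in \<open>E\<close> for some
      \<open>k\<close>, and \<open>E\<close> is a subspace containing \<open>x k\<close>.\<close>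
    have "w \<in> E"
    proof -
      obtain k where "x k - w \<in> E" using tail[of 1] xw by (metis order_refl zero_less_one)
      then have "x k - (x k - w) \<in> E" using x lim.mem_diff by blast
      then show ?thesis by simp
    qed
    moreover have "(\<lambda>k. Re (b_lim (x k - w) (x k - w))) \<longlonglongrightarrow> 0"
    proof (rule LIMSEQ_I)
      fix e :: real assume e: "0 < e"
      obtain N where N: "\<forall>k\<ge>N. \<forall>m. Re (b m (x k - w) (x k - w)) \<le> e / 2"
        using tail[of "e / 2"] e by auto
      have "norm (Re (b_lim (x k - w) (x k - w)) - 0) < e" if "k \<ge> N" for k
      proof -
        have E: "x k - w \<in> E" using xw N that by blast
        have "Re (b_lim (x k - w) (x k - w)) \<le> e / 2"
          using N that by (intro LIMSEQ_le_const2[OF limit_form_tendsto_Re[OF E]]) auto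
        then show ?thesis using lim.Re_nonneg[OF E] e by simp
      qed
      then show "\<exists>N. \<forall>k\<ge>N. norm (Re (b_lim (x k - w) (x k - w)) - 0) < e" by blast
    qed
    ultimately show "\<exists>u\<in>E. (\<lambda>k. Re (b_lim (x k - u) (x k - u))) \<longlonglongrightarrow> 0" by blast
  qed
qed

text \<open>The functional \<open>J n\<close> grows with \<open>n\<close> while its domain shrinks,
  so the infima \<open>c n\<close> increase to some \<open>l \<le> L\<close>. Near-minimizers
  \<open>x n\<close> are Cauchy for every \<open>b m\<close> by the parallelogram law, and their
  common limit is the required \<open>w\<close>.\<close>

lemma minimizer:
  assumes add: "\<And>u v. u \<in> D 0 \<Longrightarrow> v \<in> D 0 \<Longrightarrow> \<psi> (u + v) = \<psi> u + \<psi> v"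
    and scale: "\<And>u r. u \<in> D 0 \<Longrightarrow> \<psi> (r *\<^sub>R u) = r * \<psi> u"
    and C: "0 \<le> C" "\<And>u. u \<in> D 0 \<Longrightarrow> (\<psi> u)\<^sup>2 \<le> C * Re (b 0 u u)"
    and L: "\<And>n e. 0 < e \<Longrightarrow> \<exists>v\<in>D n. Re (b n v v) - 2 * \<psi> v \<le> L + e"
  obtains w where "w \<in> E" "\<And>n. Re (b n w w) - 2 * \<psi> w \<le> L"
proof -
  define J where "J = (\<lambda>n v. Re (b n v v) - 2 * \<psi> v)"
  define c where "c n = Inf (J n ` D n)" for n
  have D0: "v \<in> D 0" if "v \<in> D n" for v n using dom_mono[of 0 n] that by auto
  have J_mono: "J m v \<le> J n v" if "m \<le> n" "v \<in> D n" for m n v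
    using form_mono that by (simp add: J_def)
  have J_ge: "- C \<le> J n v" if v: "v \<in> D n" for n v
  proof -
    have q: "0 \<le> Re (b 0 v v)" using form.Re_nonneg[OF D0[OF v]] .
    \<comment> \<open>The arithmetic-geometric mean inequality gives
      \<open>2 * \<bar>\<psi> v\<bar> \<le> C + Re (b 0 v v)\<close>, hence
      \<open>J 0 v \<ge> - C\<close>.\<close>
    have "C * Re (b 0 v v) \<le> ((C + Re (b 0 v v)) / 2)\<^sup>2"
      using zero_le_power2[of "C - Re (b 0 v v)"] by (simp add: power2_eq_square field_simps)
    then have "(\<psi> v)\<^sup>2 \<le> ((C + Re (b 0 v v)) / 2)\<^sup>2"
      using C(2)[OF D0[OF v]] by simp
    then have "\<bar>\<psi> v\<bar> \<le> (C + Re (b 0 v v)) / 2"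
      using C(1) q power2_le_iff_abs_le[of "(C + Re (b 0 v v)) / 2" "\<psi> v"] by simp
    then have "- C \<le> J 0 v" by (simp add: J_def)
    then show ?thesis using J_mono[of 0 n v] v by simp
  qed
  have bdd: "bdd_below (J n ` D n)" for n using J_ge by (intro bdd_belowI2)
  have ne: "D n \<noteq> {}" for n using form.mem_0 by blast
  have c_le: "c n \<le> J n v" if "v \<in> D n" for n v
    unfolding c_def using that bdd by (intro cInf_lower) auto
  have c_mono: "c m \<le> c n" if "m \<le> n" for m n
  proof -
    have "c m \<le> J n v" if v: "v \<in> D n" for v
      using c_le[of v m] J_mono[OF \<open>m \<le> n\<close> v] dom_mono[OF \<open>m \<le> n\<close>] v by (meson order_trans subsetD)
    then show ?thesis unfolding c_def[of n] using ne by (intro cInf_greatest) auto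
  qed
  have c_L: "c n \<le> L" for n
  proof (rule field_le_epsilon)
    fix e :: real assume "0 < e"
    then show "c n \<le> L + e" using L[of e n] c_le[of _ n] by (force simp: J_def)
  qed
  obtain l where l: "c \<longlonglongrightarrow> l" "\<And>n. c n \<le> l"
    using incseq_convergent[of c L] c_mono c_L by (auto simp: incseq_def)
  have lL: "l \<le> L" using LIMSEQ_le_const2[OF l(1)] c_L by blast
  have "\<exists>v\<in>D n. J n v < c n + 1 / (real n + 1)" for n
    using cInf_lessD[of "J n ` D n" "c n + 1 / (real n + 1)"] ne by (auto simp: c_def)
  then obtain x where x: "\<And>n. x n \<in> D n" "\<And>n. J n (x n) < c n + 1 / (real n + 1)" by metis
  \<comment> \<open>The infimum \<open>c n\<close> is compared with the value at the midpoint of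
    \<open>u\<close> and \<open>v\<close>; the parallelogram law then isolates the
    difference.\<close>
  have half: "Re (b n (u - v) (u - v)) \<le> 2 * J n u + 2 * J n v - 4 * c n"
    if uv: "u \<in> D n" "v \<in> D n" for n u v
  proof -
    let ?m = "(1 / 2) *\<^sub>R (u + v)"
    have "c n \<le> J n ?m" using uv by (intro c_le form.mem_scaleR form.mem_add)
    moreover have "J n ?m = Re (b n (u + v) (u + v)) / 4 - \<psi> u - \<psi> v"
    proof -
      have "b n ?m ?m = of_real (1/4) * b n (u + v) (u + v)"
        using uv form.mem_add[of u n v]
        by (simp add: form.scaleR_left form.scaleR_right form.mem_scaleR del: scaleR_add_right)
      then have "Re (b n ?m ?m) = Re (b n (u + v) (u + v)) / 4"
        by (simp only: times_complex.simps Re_complex_of_real Im_complex_of_real)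
      moreover have "\<psi> ?m = (\<psi> u + \<psi> v) / 2"
        using scale[of "u + v" "1 / 2"] add D0 uv form.mem_add by (simp del: scaleR_add_right)
      ultimately show ?thesis by (simp add: J_def field_simps del: scaleR_add_right)
    qed
    ultimately show ?thesis
      using arg_cong[OF form.parallelogram[OF uv], of Re] by (simp add: J_def)
  qed
  \<comment> \<open>This is what \<open>half\<close> yields for \<open>x n\<close> and a later
    \<open>x k\<close>: monotonicity gives \<open>J n (x k) \<le> J k (x k)\<close>, which is below
    \<open>l + 1 / (real n + 1)\<close>.\<close>
  define \<eta> where "\<eta> = (\<lambda>n. 2 * (l - c n) + 4 * (1 / (real n + 1)))"
  have \<eta>: "Re (b n (x n - x k) (x n - x k)) \<le> \<eta> n" if "n \<le> k" for n k
  proof -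
    have xk: "x k \<in> D n" using x dom_mono[OF that] by blast
    have "1 / (real k + 1) \<le> 1 / (real n + 1)" using that by (simp add: frac_le)
    then show ?thesis
      using half[OF x(1)[of n] xk] x(2)[of n] x(2)[of k] J_mono[OF that x(1)[of k]] l(2)[of k]
      unfolding \<eta>_def by argo
  qed
  have \<eta>0: "\<eta> \<longlonglongrightarrow> 0"
  proof -
    have "\<eta> \<longlonglongrightarrow> 2 * (l - l) + 4 * 0"
      unfolding \<eta>_def using LIMSEQ_Suc[OF lim_1_over_n]
      by (intro tendsto_intros l(1)) (simp add: add.commute)
    then show ?thesis by simp
  qed
  obtain w where w: "\<And>m. w \<in> D m"
    "\<And>m. (\<lambda>k. Re (b m (x k - w) (x k - w))) \<longlonglongrightarrow> 0"
  proof (rule common_limit)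
    fix m :: nat and e :: real assume "0 < e"
    then have "\<forall>\<^sub>F n in sequentially. \<eta> n < e / 4" using order_tendstoD(2)[OF \<eta>0, of "e / 4"] by simp
    \<comment> \<open>Both \<open>x k\<close> and \<open>x l\<close> are compared with
      \<open>x N\<close> in the form \<open>b N\<close>, at a total cost of
      \<open>4 * \<eta> N\<close>; monotonicity then passes down to \<open>b m\<close>.\<close>
    then obtain N where N: "N \<ge> m" "\<eta> N < e / 4"
      unfolding eventually_sequentially by (meson max.cobounded1 max.cobounded2)
    have "Re (b m (x k - x l) (x k - x l)) < e" if kl: "k \<ge> N" "l \<ge> N" for k l
    proof -
      have D: "x i \<in> D N" if "i \<ge> N" for i using x dom_mono[OF that] by blast
      have "Re (b N ((x N - x l) - (x N - x k)) ((x N - x l) - (x N - x k))) \<le> 2 * \<eta> N + 2 * \<eta> N"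
        using form.Re_diff_le[of "x N - x l" N "x N - x k"] \<eta>[OF kl(1)] \<eta>[OF kl(2)]
          form.mem_diff[OF D D] kl by (smt (verit) order_refl)
      then show ?thesis
        using form_mono[OF N(1), of "x k - x l"] form.mem_diff[OF D D] kl N by simp
    qed
    then show "\<exists>N\<ge>m. \<forall>k\<ge>N. \<forall>l\<ge>N. Re (b m (x k - x l) (x k - x l)) < e" using N by blast
  qed (use x in auto)
  have ev: "\<forall>\<^sub>F k in sequentially. x k \<in> D m" for m
    using eventually_ge_at_top[of m] by eventually_elim (use x dom_mono in blast)
  have \<psi>_lim: "(\<lambda>k. \<psi> (x k)) \<longlonglongrightarrow> \<psi> w"
  proof -
    have "(\<lambda>k. C * Re (b 0 (x k - w) (x k - w))) \<longlonglongrightarrow> 0"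
      using tendsto_mult_left[OF w(2)[of 0], of C] by simp
    then have "(\<lambda>k. (\<psi> (x k - w))\<^sup>2) \<longlonglongrightarrow> 0"
      by (rule Lim_null_comparison[rotated])
        (use ev[of 0] in eventually_elim, use w C in \<open>auto simp: form.mem_diff\<close>)
    then have "(\<lambda>k. \<psi> (x k - w)) \<longlonglongrightarrow> 0" by simp
    moreover have "\<psi> (x k - w) = \<psi> (x k) - \<psi> w" for k
      using add[of "x k - w" w] D0[OF x(1)] w form.mem_diff by (simp add: algebra_simps)
    ultimately show ?thesis by (simp add: Lim_null[symmetric])
  qed
  \<comment> \<open>At fixed \<open>m\<close>, \<open>J m (x k)\<close> is at most
    \<open>J k (x k)\<close>, hence at most \<open>l\<close> up to an error tending to 0.\<close>
  have Jw: "J m w \<le> L" for m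
  proof -
    have "(\<lambda>k. J m (x k)) \<longlonglongrightarrow> J m w"
      unfolding J_def by (intro tendsto_intros \<psi>_lim form.tendsto_form_self ev w)
    moreover have "(\<lambda>k. l + 1 / (real k + 1)) \<longlonglongrightarrow> l + 0"
      using LIMSEQ_Suc[OF lim_1_over_n] by (intro tendsto_intros) (simp add: add.commute)
    moreover have "J m (x k) \<le> l + 1 / (real k + 1)" if "k \<ge> m" for k
      using J_mono[OF that x(1)] x(2)[of k] l(2)[of k] by linarith
    ultimately have "J m w \<le> l + 0" by (intro LIMSEQ_le) auto
    then show ?thesis using lL by simp
  qed
  \<comment> \<open>The bound on \<open>J m w\<close> is uniform in \<open>m\<close>, hence so is
    the one on \<open>Re (b m w w)\<close>.\<close>
  moreover have "w \<in> E"
    using Jw w(1) by (intro limit_domI[of _ "L + 2 * \<psi> w"]) (auto simp: J_def algebra_simps)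
  ultimately show ?thesis using that by (simp add: J_def)
qed

end

section \<open>The Lax--Milgram lemma and convergence of solutions\<close>

definition antilinear_on :: "'a::complex_vector set \<Rightarrow> ('a \<Rightarrow> complex) \<Rightarrow> bool" where
  "antilinear_on D \<Psi> \<longleftrightarrow> (\<forall>u\<in>D. \<forall>v\<in>D. \<Psi> (u + v) = \<Psi> u + \<Psi> v) \<and>
     (\<forall>u\<in>D. \<forall>c. \<Psi> (c *\<^sub>C u) = cnj c * \<Psi> u)"

lemma cinner_add_right: "cinner (x::'a::complex_inner) (y + z) = cinner x y + cinner x z"
  by (metis cinner_add_left cinner_commute complex_cnj_add)

lemma cinner_scaleC_right: "cinner (x::'a::complex_inner) (c *\<^sub>C y) = cnj c * cinner x y"
  by (metis cinner_commute cinner_scaleC_left complex_cnj_mult)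

lemma norm_cinner_self: "cmod (cinner (x::'a::complex_inner) x) = (norm x)\<^sup>2"
proof -
  have "Im (cinner x x) = 0" using arg_cong[OF cinner_commute[of x x], of Im] by simp
  then have "cinner x x = of_real ((norm x)\<^sup>2)"
    by (simp add: complex_eq_iff power2_norm_eq_cinner del: of_real_power)
  then show ?thesis by (metis norm_of_real abs_of_nonneg zero_le_power2)
qed

lemma sform_cinner: "module.subspace scaleC D \<Longrightarrow> sform D (cinner :: 'a::complex_inner \<Rightarrow> _) 1"
  by standard (auto simp: sesquilinear_on_def cinner_add_left cinner_add_right cinner_scaleC_left
      cinner_scaleC_right norm_cinner_self power2_norm_eq_cinner)

text \<open>The general \<open>Cauchy_Schwarz\<close> with \<open>M = 1\<close>, whence the factor
  4.\<close>

lemma cinner_bound: "(cmod (cinner (x::'a::complex_inner) y))\<^sup>2 \<le> 4 * (norm x)\<^sup>2 * (norm y)\<^sup>2"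
proof -
  interpret sform "UNIV :: 'a set" cinner 1
    by (rule sform_cinner) (simp add: subspace_scaleC_iff)
  show ?thesis using Cauchy_Schwarz[of x y] by (simp add: power2_norm_eq_cinner)
qed

lemma (in hform) cinner_bound_form:
  assumes "v \<in> D"
  shows "(cmod (cinner f v))\<^sup>2 \<le> 4 * (norm f)\<^sup>2 * K * Re (b v v)"
proof -
  have "4 * (norm f)\<^sup>2 * (norm v)\<^sup>2 \<le> 4 * (norm f)\<^sup>2 * (K * Re (b v v))"
    using coercive[OF assms] by (intro mult_left_mono) auto
  then show ?thesis using cinner_bound[of f v] by (simp add: mult.assoc)
qed

lemma antilinear_on_scaleR: "antilinear_on D \<Psi> \<Longrightarrow> u \<in> D \<Longrightarrow> \<Psi> (r *\<^sub>R u) = of_real r * \<Psi> u"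
  by (simp add: antilinear_on_def scaleR_scaleC)

lemma Re_power2_le: "(cmod z)\<^sup>2 \<le> C \<Longrightarrow> (Re z)\<^sup>2 \<le> C"
  using abs_Re_le_cmod[of z] by (meson abs_le_square_iff abs_norm_cancel order_trans power2_le_iff_abs_le norm_ge_zero)

lemma linear_coeff_eq_0:
  fixes p q :: real
  assumes "\<And>t. 0 \<le> t * p + t\<^sup>2 * q"
  shows "p = 0"
proof (rule ccontr)
  assume p: "p \<noteq> 0"
  \<comment> \<open>With \<open>s > q\<close> the choice \<open>t = - p / s\<close> makes the
    expression negative unless \<open>p = 0\<close>.\<close>
  define s where "s = \<bar>q\<bar> + 1"
  have s: "0 < s" "q < s" by (auto simp: s_def)
  have "0 \<le> (- p / s) * p + (- p / s)\<^sup>2 * q" by (rule assms)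
  also have "\<dots> = (p\<^sup>2 / s\<^sup>2) * (q - s)"
    using s by (simp add: field_simps power2_eq_square)
  also have "\<dots> < 0" using p s by (intro mult_pos_neg) auto
  finally show False by simp
qed

text \<open>The functional \<open>J\<close> attains its minimum at some \<open>w\<close>, where its
  derivative vanishes in every direction \<open>v\<close>. This is Riesz representation for the
  hermitian part of \<open>b\<close>, with both sides doubled.\<close>

lemma Riesz_real_part:
  fixes \<Psi> :: "'a::complex_hilbert \<Rightarrow> complex"
  assumes "hform D b M K" and \<Psi>: "antilinear_on D \<Psi>"
    and C: "0 \<le> C" "\<And>v. v \<in> D \<Longrightarrow> (cmod (\<Psi> v))\<^sup>2 \<le> C * Re (b v v)"
  obtains w where "w \<in> D" "\<And>v. v \<in> D \<Longrightarrow> b w v + cnj (b v w) = 2 * \<Psi> v"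
proof -
  interpret hform D b M K by fact
  \<comment> \<open>A constant sequence has zero increments, and its limit domain is
    \<open>D\<close>.\<close>
  interpret c: mono_forms "\<lambda>_. D" "\<lambda>_. b" M K
    by standard (auto simp: sesquilinear_on_def subspace M_pos bound K_nonneg coercive complete
        form_simps mem_0 dest: mem_scaleC intro: sesquilinear)
  define J where "J v = Re (b v v) - 2 * Re (\<Psi> v)" for v
  have ne: "D \<noteq> {}" using mem_0 by blast
  have J_ge: "- C \<le> J v" if v: "v \<in> D" for v
  proof -
    have "(Re (\<Psi> v))\<^sup>2 \<le> C * Re (b v v)" using C(2)[OF v] by (rule Re_power2_le)
    also have "C * Re (b v v) \<le> ((C + Re (b v v)) / 2)\<^sup>2"
      using zero_le_power2[of "C - Re (b v v)"] by (simp add: power2_eq_square field_simps)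
    finally have "\<bar>Re (\<Psi> v)\<bar> \<le> (C + Re (b v v)) / 2"
      using C(1) Re_nonneg[OF v] power2_le_iff_abs_le[of "(C + Re (b v v)) / 2" "Re (\<Psi> v)"]
      by simp
    then show ?thesis by (simp add: J_def)
  qed
  define L where "L = Inf (J ` D)"
  have L_le: "L \<le> J v" if "v \<in> D" for v
    unfolding L_def using that J_ge by (intro cInf_lower bdd_belowI2) auto
  obtain w where w: "w \<in> limit_dom (\<lambda>_. D) (\<lambda>_. b)" "Re (b w w) - 2 * Re (\<Psi> w) \<le> L"
  proof (rule c.minimizer[of "\<lambda>v. Re (\<Psi> v)" C L])
    fix n :: nat and e :: real assume "0 < e"
    then obtain v where "v \<in> D" "J v < L + e"
      using cInf_lessD[of "J ` D" "L + e"] ne by (auto simp: L_def)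
    then show "\<exists>v\<in>D. Re (b v v) - 2 * Re (\<Psi> v) \<le> L + e"
      by (intro bexI[of _ v]) (simp_all add: J_def)
  qed (use \<Psi> C in \<open>auto simp: antilinear_on_def antilinear_on_scaleR Re_power2_le\<close>)
  have wD: "w \<in> D" using w(1) by (auto simp: limit_dom_def)
  have Re_eq: "Re (b w v + b v w) = 2 * Re (\<Psi> v)" if v: "v \<in> D" for v
  proof -
    have "Re (b w v + b v w) - 2 * Re (\<Psi> v) = 0"
    proof (rule linear_coeff_eq_0[where q = "Re (b v v)"])
      fix t :: real
      have "J w \<le> J (w + t *\<^sub>R v)"
        using w(2) L_le[of "w + t *\<^sub>R v"] wD v by (simp add: J_def mem_add mem_scaleR)
      moreover have "\<Psi> (w + t *\<^sub>R v) = \<Psi> w + of_real t * \<Psi> v"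
        using \<Psi> wD mem_scaleR[OF v] antilinear_on_scaleR[OF \<Psi> v] by (simp add: antilinear_on_def)
      ultimately show "0 \<le> t * (Re (b w v + b v w) - 2 * Re (\<Psi> v)) + t\<^sup>2 * Re (b v v)"
        using wD v by (simp add: J_def form_simps power2_eq_square algebra_simps)
    qed
    then show ?thesis by simp
  qed
  \<comment> \<open>The derivative condition gives real parts only; applied to
    \<open>\<i> *\<^sub>C v\<close> it gives the imaginary parts.\<close>
  have "b w v + cnj (b v w) = 2 * \<Psi> v" if v: "v \<in> D" for v
  proof (rule complex_eqI)
    show "Re (b w v + cnj (b v w)) = Re (2 * \<Psi> v)" using Re_eq[OF v] by simp
    have "Re (b w (\<i> *\<^sub>C v) + b (\<i> *\<^sub>C v) w) = 2 * Re (\<Psi> (\<i> *\<^sub>C v))"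
      by (rule Re_eq) (rule mem_scaleC[OF v])
    then show "Im (b w v + cnj (b v w)) = Im (2 * \<Psi> v)"
      using \<Psi> wD v by (simp add: form_simps antilinear_on_def)
  qed
  with wD show ?thesis by (rule that)
qed

text \<open>
  Riesz' theorem is used twice: first it represents the form as \<open>b u v = h (B u) v\<close> for its real part
  \<open>h\<close>, and then it is applied to the equivalent inner product \<open>h (B u) (B v)\<close>.
\<close>

lemma Lax_Milgram:
  fixes \<Psi> :: "'a::complex_hilbert \<Rightarrow> complex"
  assumes "hform D b M K" and \<Psi>: "antilinear_on D \<Psi>"
    and C: "0 \<le> C" "\<And>v. v \<in> D \<Longrightarrow> (cmod (\<Psi> v))\<^sup>2 \<le> C * Re (b v v)"
  obtains u where "u \<in> D" "\<And>v. v \<in> D \<Longrightarrow> b u v = \<Psi> v"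
proof -
  interpret hform D b M K by fact
  define h where "h u v = (b u v + cnj (b v u)) / 2" for u v
  have h_self: "h u u = of_real (Re (b u u))" for u
    by (simp add: h_def complex_eq_iff)
  have h_cnj: "cnj (h u v) = h v u" for u v by (simp add: h_def add.commute)
  have "hform D h 1 K"
  proof
    show "sesquilinear_on D h"
      unfolding sesquilinear_on_def h_def by (simp add: form_simps field_simps)
    show "complete_form D h" using complete by (simp add: complete_form_def h_self)
    show "cmod (h u u) \<le> 1 * Re (h u u)" if "u \<in> D" for u
      using Re_nonneg[OF that] by (simp add: h_self)
  qed (use subspace K_nonneg coercive in \<open>auto simp: h_self\<close>)
  then interpret h: hform D h 1 K .
  have h_Riesz: "\<exists>w\<in>D. \<forall>v\<in>D. h w v = \<Phi> v"
    if \<Phi>: "antilinear_on D \<Phi>" "0 \<le> C'" "\<And>v. v \<in> D \<Longrightarrow> (cmod (\<Phi> v))\<^sup>2 \<le> C' * Re (b v v)" for \<Phi> C'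
  proof -
    obtain w where w: "w \<in> D" "\<And>v. v \<in> D \<Longrightarrow> b w v + cnj (b v w) = 2 * \<Phi> v"
      using Riesz_real_part[OF assms(1) \<Phi>] by blast
    then show ?thesis by (intro bexI[of _ w]) (auto simp: h_def)
  qed
  have "\<exists>w\<in>D. \<forall>v\<in>D. h w v = b u v" if u: "u \<in> D" for u
  proof (rule h_Riesz)
    show "antilinear_on D (b u)" using u by (simp add: antilinear_on_def form_simps)
    show "0 \<le> 4 * M\<^sup>2 * Re (b u u)" using Re_nonneg[OF u] by simp
  qed (rule Cauchy_Schwarz[OF u])
  then obtain B where B: "\<And>u. u \<in> D \<Longrightarrow> B u \<in> D" "\<And>u v. u \<in> D \<Longrightarrow> v \<in> D \<Longrightarrow> h (B u) v = b u v"
    by metis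
  have eqI: "x = y" if "x \<in> D" "y \<in> D" "\<And>v. v \<in> D \<Longrightarrow> h x v = h y v" for x y
  proof -
    have "h (x - y) (x - y) = 0" using that by (simp add: h.diff_left mem_diff)
    then have "x - y = 0" using that h.eq_0[of "x - y"] mem_diff by simp
    then show ?thesis by simp
  qed
  have B_add: "B (u + v) = B u + B v" if "u \<in> D" "v \<in> D" for u v
    using that by (intro eqI) (simp_all add: B h.form_simps form_simps)
  have B_scale: "B (c *\<^sub>C u) = c *\<^sub>C B u" if "u \<in> D" for u c
    using that by (intro eqI) (simp_all add: B h.form_simps form_simps)
  have B_diff: "B (u - v) = B u - B v" if "u \<in> D" "v \<in> D" for u v
    using that by (intro eqI) (simp_all add: B h.form_simps form_simps)
  have cancel: "x \<le> c" if "x\<^sup>2 \<le> c * x" "0 \<le> x" "0 \<le> c" for x c :: real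
    using that by (cases "x = 0") (auto simp: power2_eq_square)
  \<comment> \<open>This bound and \<open>B_ge\<close> make \<open>Re (h (B u) (B u))\<close> an
    equivalent squared norm on \<open>D\<close>, so the pulled-back inner product \<open>p\<close>
    inherits completeness and coercivity.\<close>
  have B_le: "Re (b (B u) (B u)) \<le> 4 * M\<^sup>2 * Re (b u u)" if u: "u \<in> D" for u
  proof (rule cancel)
    have "Re (b (B u) (B u)) = Re (b u (B u))"
      using arg_cong[OF B(2)[OF u B(1)[OF u]], of Re] by (simp add: h_self)
    then show "(Re (b (B u) (B u)))\<^sup>2 \<le> 4 * M\<^sup>2 * Re (b u u) * Re (b (B u) (B u))"
      using Re_power2_le[OF Cauchy_Schwarz[OF u B(1)[OF u]]] by simp
  qed (use u B Re_nonneg in auto)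
  have B_ge: "Re (b u u) \<le> 4 * Re (b (B u) (B u))" if u: "u \<in> D" for u
  proof (rule cancel)
    have "Re (b u u) = Re (h (B u) u)" using B u by simp
    then show "(Re (b u u))\<^sup>2 \<le> 4 * Re (b (B u) (B u)) * Re (b u u)"
      using Re_power2_le[OF h.Cauchy_Schwarz[OF B(1)[OF u] u]] by (simp add: h_self)
  qed (use u B Re_nonneg in auto)
  define p where "p u v = h (B u) (B v)" for u v
  have "hform D p 1 (4 * K)"
  proof
    show "sesquilinear_on D p"
      unfolding sesquilinear_on_def p_def by (simp add: B B_add B_scale h.form_simps)
    show "cmod (p u u) \<le> 1 * Re (p u u)" if "u \<in> D" for u
      using Re_nonneg[OF B(1)[OF that]] by (simp add: p_def h_self)
    show "(norm u)\<^sup>2 \<le> 4 * K * Re (p u u)" if "u \<in> D" for u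
      using coercive[OF that] mult_left_mono[OF B_ge[OF that] K_nonneg] by (simp add: p_def h_self)
    show "complete_form D p"
      unfolding complete_form_def
    proof (intro allI impI, elim conjE)
      fix x :: "nat \<Rightarrow> 'a"
      assume x: "range x \<subseteq> D"
        and C: "\<forall>e>0. \<exists>N. \<forall>m\<ge>N. \<forall>n\<ge>N. Re (p (x m - x n) (x m - x n)) < e"
      have xD: "x n \<in> D" for n using x by auto
      have "\<exists>N. \<forall>m\<ge>N. \<forall>n\<ge>N. Re (b (x m - x n) (x m - x n)) < e" if e: "0 < e" for e
      proof -
        obtain N where N: "\<forall>m\<ge>N. \<forall>n\<ge>N. Re (p (x m - x n) (x m - x n)) < e / 4"
          using C e by (meson divide_pos_pos zero_less_numeral)
        have "Re (b (x m - x n) (x m - x n)) < e" if "m \<ge> N" "n \<ge> N" for m n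
        proof -
          have "Re (p (x m - x n) (x m - x n)) < e / 4" using N that by blast
          then show ?thesis using B_ge[OF mem_diff[OF xD[of m] xD[of n]]] by (simp add: p_def h_self)
        qed
        then show ?thesis by blast
      qed
      then obtain u where u: "u \<in> D" "(\<lambda>n. Re (b (x n - u) (x n - u))) \<longlonglongrightarrow> 0"
        using complete x unfolding complete_form_def by blast
      have "(\<lambda>n. 4 * M\<^sup>2 * Re (b (x n - u) (x n - u))) \<longlonglongrightarrow> 0"
        using tendsto_mult_left[OF u(2), of "4 * M\<^sup>2"] by simp
      then have "(\<lambda>n. Re (p (x n - u) (x n - u))) \<longlonglongrightarrow> 0"
        by (rule Lim_null_comparison[rotated])
          (use xD u B_le mem_diff Re_nonneg B(1) in \<open>simp add: p_def h_self\<close>)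
      then show "\<exists>u\<in>D. (\<lambda>n. Re (p (x n - u) (x n - u))) \<longlonglongrightarrow> 0" using u by blast
    qed
  qed (use subspace K_nonneg in auto)
  obtain g where g: "g \<in> D" "\<And>v. v \<in> D \<Longrightarrow> h g v = \<Psi> v"
    using h_Riesz[OF \<Psi> C] by blast
  \<comment> \<open>Since \<open>p\<close> is hermitian, this says that \<open>B u - g\<close> is
    orthogonal to the range of \<open>B\<close> for \<open>h\<close>.\<close>
  obtain u where u: "u \<in> D" "\<And>v. v \<in> D \<Longrightarrow> p u v + cnj (p v u) = 2 * h g (B v)"
  proof (rule Riesz_real_part[OF \<open>hform D p 1 (4 * K)\<close>, of "\<lambda>v. h g (B v)" "4 * Re (b g g)"])
    show "antilinear_on D (\<lambda>v. h g (B v))"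
      using g by (simp add: antilinear_on_def B B_add B_scale h.form_simps)
    show "0 \<le> 4 * Re (b g g)" using Re_nonneg g by simp
    show "(cmod (h g (B v)))\<^sup>2 \<le> 4 * Re (b g g) * Re (p v v)" if "v \<in> D" for v
      using h.Cauchy_Schwarz[OF g(1) B(1)[OF that]] by (simp add: p_def h_self)
  qed blast
  \<comment> \<open>Orthogonality to \<open>B r\<close> in particular, together with
    \<open>h (B r) r = b r r\<close>, gives \<open>b r r = 0\<close>; coercivity then forces
    \<open>B u = g\<close>.\<close>
  define r where "r = B u - g"
  have r: "r \<in> D" using u g B by (simp add: r_def mem_diff)
  have "h (B u) (B r) = h g (B r)" using u(2)[OF r] by (simp add: p_def h_cnj)
  then have "h r (B r) = 0" using u g B r by (simp add: h.diff_left r_def)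
  then have "b r r = 0" using h_cnj[of r "B r"] B(2)[OF r r] by simp
  then have "r = 0" using eq_0[OF r] by simp
  then have "B u = g" by (simp add: r_def)
  then show ?thesis using that[OF u(1)] B(2)[OF u(1)] g(2) by simp
qed

section \<open>Dual bounds and convergence of the solutions\<close>

context mono_forms
begin

text \<open>A lower bound \<open>- S\<close> for \<open>Re (b v v) - 2 * Re (\<Psi> v)\<close>
  expresses that the squared dual norm of \<open>Re \<Psi>\<close> is at most \<open>S\<close>. If
  the bound failed at arbitrarily large indices, \<open>minimizer\<close> would produce an element
  of \<open>E\<close> violating it in the limit.\<close>

lemma dual_bound:
  assumes \<Psi>: "antilinear_on (D m) \<Psi>"
    and C: "0 \<le> C" "\<And>v. v \<in> D m \<Longrightarrow> (cmod (\<Psi> v))\<^sup>2 \<le> C * Re (b m v v)"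
    and S: "\<And>v. v \<in> E \<Longrightarrow> - S \<le> Re (b_lim v v) - 2 * Re (\<Psi> v)" and e: "0 < e"
  shows "\<exists>N\<ge>m. \<forall>n\<ge>N. \<forall>v\<in>D n. - S - e \<le> Re (b n v v) - 2 * Re (\<Psi> v)"
proof (rule ccontr)
  assume "\<not> ?thesis"
  then have neg: "\<exists>n v. N \<le> n \<and> v \<in> D n \<and> Re (b n v v) - 2 * Re (\<Psi> v) < - S - e" if "m \<le> N" for N
    using that by (meson not_le)
  \<comment> \<open>The sequence starts at \<open>m\<close>, because \<open>\<Psi>\<close> is
    controlled on \<open>D m\<close> only.\<close>
  interpret s: mono_forms "\<lambda>k. D (m + k)" "\<lambda>k. b (m + k)" M K
    by (rule mono_forms.intro) (use hform dom_Suc diff_Suc in simp_all)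
  obtain w where w: "w \<in> limit_dom (\<lambda>k. D (m + k)) (\<lambda>k. b (m + k))"
    "\<And>k. Re (b (m + k) w w) - 2 * Re (\<Psi> w) \<le> - S - e"
  proof (rule s.minimizer[of "\<lambda>v. Re (\<Psi> v)" C "- S - e"])
    fix k :: nat and e' :: real assume "0 < e'"
    obtain n v where nv: "m + k \<le> n" "v \<in> D n" "Re (b n v v) - 2 * Re (\<Psi> v) < - S - e"
      using neg[of "m + k"] by auto
    \<comment> \<open>A violation at a high index is also one at every lower index from
      \<open>m\<close> on, since the forms increase.\<close>
    have "v \<in> D (m + k)" using nv dom_mono by blast
    moreover have "Re (b (m + k) v v) \<le> Re (b n v v)" using nv form_mono by blast
    ultimately show "\<exists>v\<in>D (m + k). Re (b (m + k) v v) - 2 * Re (\<Psi> v) \<le> - S - e + e'"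
      using nv \<open>0 < e'\<close> by (intro bexI[of _ v]) auto
  qed (use \<Psi> C in \<open>auto simp: antilinear_on_def antilinear_on_scaleR Re_power2_le\<close>)
  have wD: "w \<in> D n" and wb: "Re (b n w w) - 2 * Re (\<Psi> w) \<le> - S - e" for n
  proof -
    have D': "w \<in> D (m + n)" using w(1) by (auto simp: limit_dom_def)
    then show "w \<in> D n" using dom_mono[of n "m + n"] by auto
    show "Re (b n w w) - 2 * Re (\<Psi> w) \<le> - S - e"
      using w(2)[of n] form_mono[of n "m + n" w] D' by simp
  qed
  have wE: "w \<in> E"
    by (rule limit_domI[of _ "2 * Re (\<Psi> w) - S - e"]) (use wD wb in \<open>auto simp: algebra_simps\<close>)
  have "Re (b_lim w w) \<le> 2 * Re (\<Psi> w) - S - e"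
    using wb by (intro LIMSEQ_le_const2[OF limit_form_tendsto_Re[OF wE]]) (auto simp: algebra_simps)
  then show False using S[OF wE] e by simp
qed

text \<open>Testing with the error \<open>u - x n\<close> gives \<open>q n\<close> as the real part
  of \<open>b n u - cinner f\<close> at that error. At a fixed large \<open>m\<close> this splits
  into \<open>b n u - b m u\<close> and \<open>\<Psi>\<close>; both are small up to a part absorbed
  by \<open>q n\<close>.\<close>

lemma solutions_tendsto:
  assumes u: "u \<in> E" "\<And>v. v \<in> E \<Longrightarrow> b_lim u v = cinner f v"
    and x: "\<And>n. x n \<in> D n" "\<And>n v. v \<in> D n \<Longrightarrow> b n (x n) v = cinner f v"
  shows "x \<longlonglongrightarrow> u"
proof -
  define q where "q n = Re (b n (u - x n) (u - x n))" for n
  have uD: "u \<in> D n" for n using u limit_dom_subset by auto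
  have d: "u - x n \<in> D n" for n using uD x by (simp add: form.mem_diff)
  have M: "0 < M" by (rule form.M_pos)
  have "q \<longlonglongrightarrow> 0"
  proof (rule LIMSEQ_I)
    fix e :: real assume e: "0 < e"
    define \<delta> where "\<delta> m = Re (b_lim u u) - Re (b m u u)" for m
    have "\<delta> \<longlonglongrightarrow> Re (b_lim u u) - Re (b_lim u u)"
      unfolding \<delta>_def by (intro tendsto_intros limit_form_tendsto_Re u)
    then have "\<forall>\<^sub>F m in sequentially. \<delta> m < e / (64 * M\<^sup>2)"
      using e M by (intro order_tendstoD) auto
    then obtain m where m: "\<delta> m < e / (64 * M\<^sup>2)" by (auto simp: eventually_sequentially)
    then have \<delta>: "M\<^sup>2 * \<delta> m < e / 64" using M by (simp add: field_simps)
    define \<Psi> where "\<Psi> v = b m u v - cinner f v" for v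
    \<comment> \<open>The weight \<open>4 * M\<close> leaves only a quarter of
      \<open>Re (b n v v)\<close>, which can be absorbed, while the remaining term is independent of
      \<open>n\<close>.\<close>
    have bn: "cmod (b n u v - b m u v) \<le> 4 * (M\<^sup>2 * \<delta> m) + Re (b n v v) / 4"
      if n: "m \<le> n" and v: "v \<in> D n" for n v
    proof -
      interpret d: sform "D n" "\<lambda>u v. b n u v - b m u v" M by (rule diff_form[OF n])
      have "cmod (b n u v - b m u v) \<le>
          M * (4 * M * (Re (b n u u) - Re (b m u u)) + (Re (b n v v) - Re (b m v v)) / (4 * M))"
        using d.cmod_le_AM_GM[OF uD v, of "4 * M"] M by simp
      also have "\<dots> = 4 * (M\<^sup>2 * (Re (b n u u) - Re (b m u u))) + (Re (b n v v) - Re (b m v v)) / 4"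
        using M by (simp add: field_simps power2_eq_square)
      also have "\<dots> \<le> 4 * (M\<^sup>2 * \<delta> m) + Re (b n v v) / 4"
      proof -
        have "Re (b n u u) - Re (b m u u) \<le> \<delta> m"
          using limit_form_ge[OF u(1)] by (simp add: \<delta>_def)
        moreover have "0 \<le> Re (b m v v)" using form.Re_nonneg v dom_mono[OF n] by blast
        ultimately show ?thesis by (intro add_mono mult_left_mono divide_right_mono) auto
      qed
      finally show ?thesis .
    qed
    have "\<exists>N\<ge>m. \<forall>n\<ge>N. \<forall>v\<in>D n.
        - (8 * (M\<^sup>2 * \<delta> m)) - e / 8 \<le> Re (b n v v) - 2 * Re (\<Psi> v)"
    proof (rule dual_bound[of m \<Psi> "8 * M\<^sup>2 * Re (b m u u) + 8 * (norm f)\<^sup>2 * K" "8 * (M\<^sup>2 * \<delta> m)" "e / 8"])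
      show "antilinear_on (D m) \<Psi>"
        unfolding antilinear_on_def \<Psi>_def using uD
        by (simp add: form.form_simps cinner_add_right cinner_scaleC_right algebra_simps)
      show "0 \<le> 8 * M\<^sup>2 * Re (b m u u) + 8 * (norm f)\<^sup>2 * K"
        using form.Re_nonneg[OF uD, of m] form.K_nonneg by simp
      show "(cmod (\<Psi> v))\<^sup>2 \<le> (8 * M\<^sup>2 * Re (b m u u) + 8 * (norm f)\<^sup>2 * K) * Re (b m v v)"
        if v: "v \<in> D m" for v
      proof -
        have "(cmod (\<Psi> v))\<^sup>2 \<le> (cmod (b m u v) + cmod (cinner f v))\<^sup>2"
          unfolding \<Psi>_def by (intro power_mono norm_triangle_ineq4) auto
        also have "\<dots> \<le> 2 * (cmod (b m u v))\<^sup>2 + 2 * (cmod (cinner f v))\<^sup>2"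
          using zero_le_power2[of "cmod (b m u v) - cmod (cinner f v)"]
          by (simp add: power2_eq_square algebra_simps)
        also have "\<dots> \<le> 2 * (4 * M\<^sup>2 * Re (b m u u) * Re (b m v v)) +
            2 * (4 * (norm f)\<^sup>2 * K * Re (b m v v))"
          using form.Cauchy_Schwarz[OF uD v] form.cinner_bound_form[OF v, of f] by simp
        finally show ?thesis by (simp add: algebra_simps)
      qed
      \<comment> \<open>On \<open>E\<close> the equation for \<open>u\<close> turns
        \<open>\<Psi> v\<close> into \<open>b m u v - b_lim u v\<close>, and \<open>bn\<close>
        passes to the limit in \<open>n\<close>.\<close>
      show "- (8 * (M\<^sup>2 * \<delta> m)) \<le> Re (b_lim v v) - 2 * Re (\<Psi> v)" if v: "v \<in> E" for v
      proof -
        have "(\<lambda>n. cmod (b n u v - b m u v)) \<longlonglongrightarrow> cmod (b_lim u v - b m u v)"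
          by (intro tendsto_intros limit_form_tendsto u v)
        moreover have "(\<lambda>n. 4 * (M\<^sup>2 * \<delta> m) + Re (b n v v) / 4) \<longlonglongrightarrow>
            4 * (M\<^sup>2 * \<delta> m) + Re (b_lim v v) / 4"
          by (intro tendsto_intros limit_form_tendsto_Re v) simp
        ultimately have "cmod (b_lim u v - b m u v) \<le> 4 * (M\<^sup>2 * \<delta> m) + Re (b_lim v v) / 4"
          using bn v limit_dom_subset by (intro LIMSEQ_le) (auto intro!: exI[of _ m])
        moreover have "\<Psi> v = - (b_lim u v - b m u v)" using u(2)[OF v] by (simp add: \<Psi>_def)
        ultimately have "Re (\<Psi> v) \<le> 4 * (M\<^sup>2 * \<delta> m) + Re (b_lim v v) / 4"
          using complex_Re_le_cmod[of "\<Psi> v"] by (simp add: norm_minus_commute)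
        then show ?thesis using lim.Re_nonneg[OF v] by simp
      qed
    qed (use e in auto)
    then obtain N where N: "m \<le> N" "\<And>n v. N \<le> n \<Longrightarrow> v \<in> D n \<Longrightarrow>
        - (8 * (M\<^sup>2 * \<delta> m)) - e / 8 \<le> Re (b n v v) - 2 * Re (\<Psi> v)" by blast
    have "norm (q n - 0) < e" if n: "N \<le> n" for n
    proof -
      let ?d = "u - x n"
      have mn: "m \<le> n" using N n by simp
      have q: "q n = Re (b n u ?d - cinner f ?d)"
        unfolding q_def using x(2)[OF d, of n] x(1) uD d by (simp add: form.diff_left)
      also have "\<dots> = Re (b n u ?d - b m u ?d) + Re (\<Psi> ?d)" by (simp add: \<Psi>_def)
      also have "\<dots> \<le> 4 * (M\<^sup>2 * \<delta> m) + q n / 4 + Re (\<Psi> ?d)"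
        using bn[OF mn d] complex_Re_le_cmod[of "b n u ?d - b m u ?d"] unfolding q_def by linarith
      \<comment> \<open>The dual bound contributes
        \<open>q n / 2 + 4 * (M\<^sup>2 * \<delta> m) + e / 16\<close>. Hence three quarters of
        \<open>q n\<close> are absorbed and \<open>q n / 4 < e / 8 + e / 16\<close>.\<close>
      finally have "q n < e"
        using N(2)[OF n d] \<delta> e unfolding q_def by linarith
      moreover have "0 \<le> q n" unfolding q_def by (rule form.Re_nonneg[OF d])
      ultimately show ?thesis by simp
    qed
    then show "\<exists>N. \<forall>n\<ge>N. norm (q n - 0) < e" by blast
  qed
  then have "(\<lambda>n. K * q n) \<longlonglongrightarrow> 0" using tendsto_mult_left[of q 0 _ K] by simp
  then have "(\<lambda>n. (norm (u - x n))\<^sup>2) \<longlonglongrightarrow> 0"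
    by (rule Lim_null_comparison[rotated]) (use form.coercive[OF d] in \<open>simp add: q_def\<close>)
  then have "(\<lambda>n. norm (x n - u)) \<longlonglongrightarrow> 0" by (simp add: norm_minus_commute)
  then show ?thesis by (simp add: tendsto_norm_zero_iff Lim_null[symmetric])
qed

end

section \<open>Associated relations and resolvents\<close>

text \<open>Adding the inner product turns \<open>Re (b u u)\<close> into the square of
  \<open>form_norm a u\<close>, so closedness becomes completeness and coercivity holds with
  constant 1.\<close>

lemma closed_sectorial_form_hform:
  assumes "0 \<le> \<theta>" "\<theta> < pi / 2" and c: "closed_sectorial_form \<theta> D a"
  shows "hform D (\<lambda>u v. a u v + cinner u v) (1 + tan \<theta>) 1"
proof -
  have sub: "module.subspace scaleC D" and ses: "sesquilinear_on D a"
    and sec: "\<And>u. u \<in> D \<Longrightarrow> a u u \<in> closure (sector \<theta>)"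
    using c by (auto simp: closed_sectorial_form_def sectorial_form_def)
  have tan: "0 \<le> tan \<theta>" using assms tan_gt_zero[of \<theta>] by (cases "\<theta> = 0") auto
  interpret a: sform D a "1 + tan \<theta>"
    by standard (use sub ses sec tan closure_sector_bound assms in auto)
  \<comment> \<open>Since \<open>1 \<le> 1 + tan \<theta>\<close>, the inner product satisfies the
    bound with the same constant as \<open>a\<close>.\<close>
  interpret cinner: sform D cinner "1 + tan \<theta>"
  proof -
    interpret s: sform D cinner 1 by (rule sform_cinner[OF sub])
    show "sform D cinner (1 + tan \<theta>)"
      by standard (use s.subspace s.sesquilinear tan in
          \<open>auto simp: norm_cinner_self distrib_right simp flip: power2_norm_eq_cinner\<close>)
  qed
  interpret b: sform D "\<lambda>u v. a u v + cinner u v" "1 + tan \<theta>"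
    by (rule sform_add) unfold_locales
  have norm_eq: "form_norm a u = sqrt (Re (a u u + cinner u u))" for u
    by (simp add: form_norm_def power2_norm_eq_cinner)
  show ?thesis
  proof
    show "(norm u)\<^sup>2 \<le> 1 * Re (a u u + cinner u u)" if "u \<in> D" for u
      using a.Re_nonneg[OF that] by (simp add: power2_norm_eq_cinner)
    show "complete_form D (\<lambda>u v. a u v + cinner u v)"
      unfolding complete_form_def
    proof (intro allI impI, elim conjE)
      fix x :: "nat \<Rightarrow> 'a"
      assume x: "range x \<subseteq> D"
        and C: "\<forall>e>0. \<exists>N. \<forall>m\<ge>N. \<forall>n\<ge>N. Re (a (x m - x n) (x m - x n) + cinner (x m - x n) (x m - x n)) < e"
      have "\<exists>N. \<forall>m\<ge>N. \<forall>n\<ge>N. form_norm a (x m - x n) < e" if e: "0 < e" for e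
      proof -
        obtain N where "\<forall>m\<ge>N. \<forall>n\<ge>N. Re (a (x m - x n) (x m - x n) + cinner (x m - x n) (x m - x n)) < e\<^sup>2"
          using C e by (meson zero_less_power)
        then have "\<forall>m\<ge>N. \<forall>n\<ge>N. form_norm a (x m - x n) < e"
          unfolding norm_eq using e by (auto intro!: real_less_lsqrt)
        then show ?thesis by blast
      qed
      then obtain u where u: "u \<in> D" "(\<lambda>n. form_norm a (x n - u)) \<longlonglongrightarrow> 0"
        using c x unfolding closed_sectorial_form_def by blast
      have "(\<lambda>n. (form_norm a (x n - u))\<^sup>2) \<longlonglongrightarrow> 0\<^sup>2" by (intro tendsto_power u)
      moreover have "(form_norm a (x n - u))\<^sup>2 = Re (a (x n - u) (x n - u) + cinner (x n - u) (x n - u))" for n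
        using b.Re_nonneg[OF b.mem_diff[of "x n" u]] x u unfolding norm_eq
        by (auto intro: real_sqrt_pow2)
      ultimately show "\<exists>u\<in>D. (\<lambda>n. Re (a (x n - u) (x n - u) + cinner (x n - u) (x n - u))) \<longlonglongrightarrow> 0"
        using u by auto
    qed
  qed simp
qed

lemma hform_closed_sectorial_form:
  assumes "hform D b M K" "sectorial_form \<theta> D a"
    and "\<And>u v. u \<in> D \<Longrightarrow> v \<in> D \<Longrightarrow> b u v = a u v + cinner u v"
  shows "closed_sectorial_form \<theta> D a"
proof -
  interpret hform D b M K by fact
  have norm_eq: "form_norm a u = sqrt (Re (b u u))" if "u \<in> D" for u
    using that assms(3) by (simp add: form_norm_def power2_norm_eq_cinner)
  show ?thesis
    unfolding closed_sectorial_form_def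
  proof (intro conjI allI impI, rule assms(2), elim conjE)
    fix x :: "nat \<Rightarrow> 'a"
    assume x: "range x \<subseteq> D"
      and C: "\<forall>e>0. \<exists>N. \<forall>m\<ge>N. \<forall>n\<ge>N. form_norm a (x m - x n) < e"
    have xD: "x n \<in> D" for n using x by auto
    have "\<exists>N. \<forall>m\<ge>N. \<forall>n\<ge>N. Re (b (x m - x n) (x m - x n)) < e" if e: "0 < e" for e
    proof -
      obtain N where "\<forall>m\<ge>N. \<forall>n\<ge>N. form_norm a (x m - x n) < sqrt e"
        using C e by (meson real_sqrt_gt_zero)
      then have "\<forall>m\<ge>N. \<forall>n\<ge>N. Re (b (x m - x n) (x m - x n)) < e"
        using xD by (simp add: norm_eq mem_diff)
      then show ?thesis by blast
    qed
    then obtain u where u: "u \<in> D" "(\<lambda>n. Re (b (x n - u) (x n - u))) \<longlonglongrightarrow> 0"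
      using complete x unfolding complete_form_def by blast
    have "(\<lambda>n. sqrt (Re (b (x n - u) (x n - u)))) \<longlonglongrightarrow> sqrt 0" by (intro tendsto_intros u)
    then show "\<exists>u\<in>D. (\<lambda>n. form_norm a (x n - u)) \<longlonglongrightarrow> 0"
      using u xD by (intro bexI[of _ u]) (simp_all add: norm_eq mem_diff)
  qed
qed

section \<open>The resolvent equation and m-sectoriality\<close>

lemma antilinear_on_cinner: "antilinear_on D (cinner (f :: 'a::complex_inner))"
  by (simp add: antilinear_on_def cinner_add_right cinner_scaleC_right)

text \<open>Subtracting \<open>cinner u v\<close> from the Lax--Milgram equation
  \<open>b u v = cinner f v\<close> leaves \<open>a u v = cinner (f - u) v\<close>, so
  \<open>u\<close> is the resolvent applied to \<open>f\<close>.\<close>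

lemma associated_relation_solution:
  assumes "hform D b M K"
    and b: "\<And>u v. u \<in> D \<Longrightarrow> v \<in> D \<Longrightarrow> b u v = a u v + cinner u v"
  obtains u where "(u, f - u) \<in> associated_relation D a"
    "\<And>v. v \<in> D \<Longrightarrow> b u v = cinner f v"
proof -
  interpret hform D b M K by fact
  obtain u where u: "u \<in> D" "\<And>v. v \<in> D \<Longrightarrow> b u v = cinner f v"
  proof (rule Lax_Milgram[OF assms(1) antilinear_on_cinner])
    show "0 \<le> 4 * (norm f)\<^sup>2 * K" using K_nonneg by simp
  qed (use cinner_bound_form in blast)+
  have "cinner (f - u) v = cinner f v - cinner u v" for v
    using cinner_add_left[of "f - u" u v] by simp
  then have "(u, f - u) \<in> associated_relation D a"
    using u b by (fastforce simp: associated_relation_def)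
  then show ?thesis using that u by blast
qed

text \<open>Testing with \<open>v = x\<close> gives \<open>cinner y x = a x x\<close>, which lies in
  the closed sector; the range condition is solvability of the resolvent equation.\<close>

lemma m_sectorial_associated_relation:
  assumes "hform D b M K" "sectorial_form \<theta> D a"
    and b: "\<And>u v. u \<in> D \<Longrightarrow> v \<in> D \<Longrightarrow> b u v = a u v + cinner u v"
  shows "m_sectorial \<theta> (associated_relation D a)"
proof -
  interpret a: sesq D a using assms(2) by unfold_locales (auto simp: sectorial_form_def)
  have z: "cinner 0 v = 0" for v :: 'a using cinner_add_left[of 0 0 v] by simp
  have "linear_relation (associated_relation D a)"
    unfolding linear_relation_iff associated_relation_def
    using a.scaleC_left[of 0 _ 0]
    by (auto simp: a.form_simps a.mem_0 z cinner_add_left cinner_scaleC_left zero_prod_def)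
      (metis a.mem_0 a.add_left add_cancel_right_left)
  moreover have "\<forall>(x, y)\<in>associated_relation D a. cinner y x \<in> closure (sector \<theta>)"
    using assms(2) by (auto simp: associated_relation_def sectorial_form_def)
  moreover have "Range (id_plus (associated_relation D a)) = UNIV"
  proof -
    have "f \<in> Range (id_plus (associated_relation D a))" for f
    proof -
      obtain u where "(u, f - u) \<in> associated_relation D a"
        using associated_relation_solution[OF assms(1) b] by blast
      then have "(u, u + (f - u)) \<in> id_plus (associated_relation D a)" unfolding id_plus_def by blast
      then show ?thesis by auto
    qed
    then show ?thesis by blast
  qed
  ultimately show ?thesis by (simp add: m_sectorial_def)
qed

lemma resolvent_eqI:
  assumes "\<theta> < pi / 2" "m_sectorial \<theta> A" "(u, f - u) \<in> A"
  shows "resolvent A f = u"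
proof -
  have "(u, u + (f - u)) \<in> id_plus A" using assms(3) unfolding id_plus_def by blast
  then have "(f, u) \<in> (id_plus A)\<inverse>" by simp
  then show ?thesis
    unfolding resolvent_def using m_sectorial_resolvent_unique[OF assms(1,2)] by (rule the1_equality[rotated])
qed

theorem theorem3p1:
  fixes \<theta> :: real
    and D :: "nat \<Rightarrow> 'a::complex_hilbert set"
    and a :: "nat \<Rightarrow> 'a \<Rightarrow> 'a \<Rightarrow> complex"
  assumes "0 \<le> \<theta>" and "\<theta> < pi / 2"
    and "\<And>n. closed_sectorial_form \<theta> (D n) (a n)"
    and "\<And>n. D (Suc n) \<subseteq> D n"
    and "\<And>n. sectorial_form \<theta> (D (Suc n)) (\<lambda>u v. a (Suc n) u v - a n u v)"
  shows "(\<forall>u\<in>limit_dom D a. \<forall>v\<in>limit_dom D a. convergent (\<lambda>n. a n u v)) \<and>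
    closed_sectorial_form \<theta> (limit_dom D a) (limit_form a) \<and>
    (\<forall>n. m_sectorial \<theta> (associated_relation (D n) (a n))) \<and>
    m_sectorial \<theta> (associated_relation (limit_dom D a) (limit_form a)) \<and>
    strong_resolvent_conv (\<lambda>n. associated_relation (D n) (a n))
      (associated_relation (limit_dom D a) (limit_form a))"
proof -
  define b where "b n u v = a n u v + cinner u v" for n u v
  define M where "M = 1 + tan \<theta>"
  have hform: "hform (D n) (b n) M 1" for n
    using closed_sectorial_form_hform[OF assms(1,2,3)] by (simp add: b_def[abs_def] M_def)
  \<comment> \<open>The inner product cancels in the increments of \<open>b\<close>, which are
    therefore those of \<open>a\<close>.\<close>
  interpret mono_forms D b M 1
  proof (rule mono_forms.intro)
    show "sform (D (Suc n)) (\<lambda>u v. b (Suc n) u v - b n u v) M" for n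
    proof
      show "module.subspace scaleC (D (Suc n))" "sesquilinear_on (D (Suc n)) (\<lambda>u v. b (Suc n) u v - b n u v)"
        using assms(5)[of n] by (simp_all add: sectorial_form_def b_def)
      show "cmod (b (Suc n) u u - b n u u) \<le> M * Re (b (Suc n) u u - b n u u)" if "u \<in> D (Suc n)" for u
        using closure_sector_bound[OF assms(1,2), of "a (Suc n) u u - a n u u"] assms(5)[of n] that
        by (simp add: sectorial_form_def b_def M_def)
      show "0 < M" using hform[of 0] by (simp add: hform_def sform_def sform_axioms_def)
    qed
  qed (rule hform assms(4))+
  \<comment> \<open>For fixed \<open>u\<close> the two sequences of real parts differ by a
    constant.\<close>
  have dom: "limit_dom D a = E"
  proof -
    have "bdd_above (range (\<lambda>n. Re (b n u u))) \<longleftrightarrow> bdd_above (range (\<lambda>n. Re (a n u u)))" for u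
    proof
      assume "bdd_above (range (\<lambda>n. Re (b n u u)))"
      then obtain B where "\<And>n. Re (a n u u) + Re (cinner u u) \<le> B"
        by (auto simp: bdd_above_def b_def)
      then show "bdd_above (range (\<lambda>n. Re (a n u u)))"
        by (intro bdd_aboveI2[of _ _ "B - Re (cinner u u)"]) (simp add: le_diff_eq)
    next
      assume "bdd_above (range (\<lambda>n. Re (a n u u)))"
      then obtain B where "\<And>n. Re (a n u u) \<le> B" by (auto simp: bdd_above_def)
      then show "bdd_above (range (\<lambda>n. Re (b n u u)))"
        by (intro bdd_aboveI2[of _ _ "B + Re (cinner u u)"]) (simp add: b_def)
    qed
    then show ?thesis by (simp add: limit_dom_def)
  qed
  have lim_a: "(\<lambda>n. a n u v) \<longlonglongrightarrow> b_lim u v - cinner u v" if "u \<in> E" "v \<in> E" for u v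
    using tendsto_diff[OF limit_form_tendsto[OF that] tendsto_const[of "cinner u v"]]
    by (simp add: b_def)
  have form_a: "limit_form a u v = b_lim u v - cinner u v" if "u \<in> E" "v \<in> E" for u v
    unfolding limit_form_def[of a] using lim_a[OF that] by (rule limI)
  have b_lim: "b_lim u v = limit_form a u v + cinner u v" if "u \<in> E" "v \<in> E" for u v
    using form_a[OF that] by simp
  have sect: "sectorial_form \<theta> (D n) (a n)" for n
    using assms(3) by (simp add: closed_sectorial_form_def)
  have sect_lim: "sectorial_form \<theta> E (limit_form a)"
    unfolding sectorial_form_def
  proof (intro conjI ballI)
    show "sesquilinear_on E (limit_form a)"
      unfolding sesquilinear_on_def
      by (simp add: form_a lim.form_simps cinner_add_left cinner_add_right cinner_scaleC_left
          cinner_scaleC_right algebra_simps)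
    \<comment> \<open>The angle itself is preserved because the closed sector is stable under
      limits.\<close>
    show "limit_form a u u \<in> closure (sector \<theta>)" if "u \<in> E" for u
    proof (rule Lim_in_closed_set)
      show "(\<lambda>n. a n u u) \<longlonglongrightarrow> limit_form a u u" using lim_a form_a that by simp
      show "\<forall>\<^sub>F n in sequentially. a n u u \<in> closure (sector \<theta>)"
        using sect subsetD[OF limit_dom_subset that] by (simp add: sectorial_form_def)
    qed simp_all
  qed (rule lim.subspace)
  have m_sect: "m_sectorial \<theta> (associated_relation (D n) (a n))" for n
    by (rule m_sectorial_associated_relation[OF hform sect]) (simp add: b_def)
  have m_sect_lim: "m_sectorial \<theta> (associated_relation E (limit_form a))"
    using lim.hform_axioms sect_lim b_lim by (rule m_sectorial_associated_relation)
  have "(\<lambda>n. resolvent (associated_relation (D n) (a n)) f) \<longlonglongrightarrow>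
      resolvent (associated_relation E (limit_form a)) f" for f
  proof -
    have "\<exists>x. (x, f - x) \<in> associated_relation (D n) (a n) \<and> (\<forall>v\<in>D n. b n x v = cinner f v)" for n
      by (rule associated_relation_solution[OF hform]) (auto simp: b_def)
    then obtain x where x: "\<And>n. (x n, f - x n) \<in> associated_relation (D n) (a n)"
        "\<And>n v. v \<in> D n \<Longrightarrow> b n (x n) v = cinner f v"
      by metis
    obtain u where u: "(u, f - u) \<in> associated_relation E (limit_form a)"
        "\<And>v. v \<in> E \<Longrightarrow> b_lim u v = cinner f v"
      using associated_relation_solution[OF lim.hform_axioms b_lim] by blast
    have "x \<longlonglongrightarrow> u"
      using x u by (intro solutions_tendsto) (auto simp: associated_relation_def)
    moreover have "resolvent (associated_relation (D n) (a n)) f = x n" for n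
      using assms(2) m_sect x(1) by (rule resolvent_eqI)
    moreover have "resolvent (associated_relation E (limit_form a)) f = u"
      using assms(2) m_sect_lim u(1) by (rule resolvent_eqI)
    ultimately show ?thesis by simp
  qed
  then show ?thesis
    using lim_a m_sect m_sect_lim hform_closed_sectorial_form[OF lim.hform_axioms sect_lim b_lim]
    unfolding dom strong_resolvent_conv_def by (auto intro: convergentI)
qed

end
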